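(* Let $(\mathcal{S}^x,H)$ be a finite thick skew translation generalized quadrangle of order $(s,t)$ with $s\neq t$, satisfying property ( * ), and suppose that for every line $L$ not incident with $x$ the stabilizer $H_L$ is elementary abelian. Then for every line $L$ not incident with $x$, $H_L$ contains at least $s/t>1$ elements which fix every line through the point $\mathrm{proj}_Lx$ (i.e., root-elations with i-root $(x,\,x\,\mathrm{proj}_Lx,\,\mathrm{proj}_Lx)$).
   Context: A finite generalized quadrangle (GQ) of order $(s,t)$: every line has $s+1$ points, every point is on $t+1$ lines, two points are on at most one common line, and for each point $p$ not on a line $L$ there is a unique point of $L$ collinear with $p$, denoted $\mathrm{proj}_Lp$; thick means $s,t>1$. An elation generalized quadrangle $(\mathcal{S}^x,H)$: $H\le\mathrm{Aut}(\mathcal{S})$ fixes every line through $x$ and acts sharply transitively on the points not collinear with $x$. A symmetry about $x$ is an automorphism fixing every point collinear with $x$; the EGQ is a skew translation generalized quadrangle if $H$ contains a subgroup of $t$ symmetries about $x$. Property ( * ): whenever a point $y\neq x$ collinear with $x$ is fixed by some element $h\in H$, then $h$ fixes every point of the line $xy$. *)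

theory Defs
  imports Complex_Main "HOL-Combinatorics.Permutations" "HOL-Computational_Algebra.Primes"
begin

definition collinear :: "'l set \<Rightarrow> ('p \<Rightarrow> 'l \<Rightarrow> bool) \<Rightarrow> 'p \<Rightarrow> 'p \<Rightarrow> bool" where
  "collinear Ls I p q \<longleftrightarrow> (\<exists>l\<in>Ls. I p l \<and> I q l)"

definition finite_GQ :: "'p set \<Rightarrow> 'l set \<Rightarrow> ('p \<Rightarrow> 'l \<Rightarrow> bool) \<Rightarrow> nat \<Rightarrow> nat \<Rightarrow> bool" where
  "finite_GQ P Ls I s t \<longleftrightarrow>
     finite P \<and> finite Ls \<and>
     (\<forall>l\<in>Ls. card {p\<in>P. I p l} = s + 1) \<and>
     (\<forall>p\<in>P. card {l\<in>Ls. I p l} = t + 1) \<and>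
     (\<forall>p\<in>P. \<forall>q\<in>P. p \<noteq> q \<longrightarrow> card {l\<in>Ls. I p l \<and> I q l} \<le> 1) \<and>
     (\<forall>p\<in>P. \<forall>l\<in>Ls. \<not> I p l \<longrightarrow> (\<exists>!q. q \<in> P \<and> I q l \<and> collinear Ls I p q))"

text \<open>The point of line l collinear with p (for p not on l).\<close>
definition proj :: "'p set \<Rightarrow> 'l set \<Rightarrow> ('p \<Rightarrow> 'l \<Rightarrow> bool) \<Rightarrow> 'l \<Rightarrow> 'p \<Rightarrow> 'p" where
  "proj P Ls I l p = (THE q. q \<in> P \<and> I q l \<and> collinear Ls I p q)"

text \<open>Automorphisms as pairs (permutation of points, permutation of lines)
  preserving incidence; they act as the identity outside the carriers.\<close>
definition automorphism :: "'p set \<Rightarrow> 'l set \<Rightarrow> ('p \<Rightarrow> 'l \<Rightarrow> bool) \<Rightarrow> ('p \<Rightarrow> 'p) \<times> ('l \<Rightarrow> 'l) \<Rightarrow> bool" where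
  "automorphism P Ls I h \<longleftrightarrow>
     fst h permutes P \<and> snd h permutes Ls \<and>
     (\<forall>p\<in>P. \<forall>l\<in>Ls. I (fst h p) (snd h l) \<longleftrightarrow> I p l)"

definition aut_id :: "('p \<Rightarrow> 'p) \<times> ('l \<Rightarrow> 'l)" where
  "aut_id = (id, id)"

definition aut_comp :: "('p \<Rightarrow> 'p) \<times> ('l \<Rightarrow> 'l) \<Rightarrow> ('p \<Rightarrow> 'p) \<times> ('l \<Rightarrow> 'l) \<Rightarrow> ('p \<Rightarrow> 'p) \<times> ('l \<Rightarrow> 'l)" where
  "aut_comp g h = (fst g \<circ> fst h, snd g \<circ> snd h)"

definition aut_inv :: "('p \<Rightarrow> 'p) \<times> ('l \<Rightarrow> 'l) \<Rightarrow> ('p \<Rightarrow> 'p) \<times> ('l \<Rightarrow> 'l)" where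
  "aut_inv h = (inv (fst h), inv (snd h))"

definition aut_pow :: "('p \<Rightarrow> 'p) \<times> ('l \<Rightarrow> 'l) \<Rightarrow> nat \<Rightarrow> ('p \<Rightarrow> 'p) \<times> ('l \<Rightarrow> 'l)" where
  "aut_pow h n = (fst h ^^ n, snd h ^^ n)"

definition is_group :: "(('p \<Rightarrow> 'p) \<times> ('l \<Rightarrow> 'l)) set \<Rightarrow> bool" where
  "is_group G \<longleftrightarrow> aut_id \<in> G \<and> (\<forall>g\<in>G. \<forall>h\<in>G. aut_comp g h \<in> G) \<and> (\<forall>g\<in>G. aut_inv g \<in> G)"

definition aut_group :: "'p set \<Rightarrow> 'l set \<Rightarrow> ('p \<Rightarrow> 'l \<Rightarrow> bool) \<Rightarrow> (('p \<Rightarrow> 'p) \<times> ('l \<Rightarrow> 'l)) set \<Rightarrow> bool" where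
  "aut_group P Ls I H \<longleftrightarrow> is_group H \<and> (\<forall>h\<in>H. automorphism P Ls I h)"

definition far_points :: "'p set \<Rightarrow> 'l set \<Rightarrow> ('p \<Rightarrow> 'l \<Rightarrow> bool) \<Rightarrow> 'p \<Rightarrow> 'p set" where
  "far_points P Ls I x = {p\<in>P. p \<noteq> x \<and> \<not> collinear Ls I x p}"

definition elation_GQ :: "'p set \<Rightarrow> 'l set \<Rightarrow> ('p \<Rightarrow> 'l \<Rightarrow> bool) \<Rightarrow> nat \<Rightarrow> nat \<Rightarrow> 'p \<Rightarrow> (('p \<Rightarrow> 'p) \<times> ('l \<Rightarrow> 'l)) set \<Rightarrow> bool" where
  "elation_GQ P Ls I s t x H \<longleftrightarrow>
     finite_GQ P Ls I s t \<and> x \<in> P \<and> aut_group P Ls I H \<and>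
     (\<forall>h\<in>H. \<forall>l\<in>Ls. I x l \<longrightarrow> snd h l = l) \<and>
     (\<forall>p\<in>far_points P Ls I x. \<forall>q\<in>far_points P Ls I x. \<exists>!h. h \<in> H \<and> fst h p = q)"

definition symmetry_about :: "'p set \<Rightarrow> 'l set \<Rightarrow> ('p \<Rightarrow> 'l \<Rightarrow> bool) \<Rightarrow> 'p \<Rightarrow> ('p \<Rightarrow> 'p) \<times> ('l \<Rightarrow> 'l) \<Rightarrow> bool" where
  "symmetry_about P Ls I x h \<longleftrightarrow> automorphism P Ls I h \<and>
     (\<forall>y\<in>P. (y = x \<or> collinear Ls I x y) \<longrightarrow> fst h y = y)"

definition skew_translation_GQ :: "'p set \<Rightarrow> 'l set \<Rightarrow> ('p \<Rightarrow> 'l \<Rightarrow> bool) \<Rightarrow> nat \<Rightarrow> nat \<Rightarrow> 'p \<Rightarrow> (('p \<Rightarrow> 'p) \<times> ('l \<Rightarrow> 'l)) set \<Rightarrow> bool" where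
  "skew_translation_GQ P Ls I s t x H \<longleftrightarrow> elation_GQ P Ls I s t x H \<and>
     (\<exists>S. S \<subseteq> H \<and> is_group S \<and> card S = t \<and> (\<forall>h\<in>S. symmetry_about P Ls I x h))"

definition property_star :: "'p set \<Rightarrow> 'l set \<Rightarrow> ('p \<Rightarrow> 'l \<Rightarrow> bool) \<Rightarrow> 'p \<Rightarrow> (('p \<Rightarrow> 'p) \<times> ('l \<Rightarrow> 'l)) set \<Rightarrow> bool" where
  "property_star P Ls I x H \<longleftrightarrow>
     (\<forall>y\<in>P. \<forall>l\<in>Ls. y \<noteq> x \<and> I x l \<and> I y l \<longrightarrow>
        (\<forall>h\<in>H. fst h y = y \<longrightarrow> (\<forall>z\<in>P. I z l \<longrightarrow> fst h z = z)))"

definition line_stabilizer :: "(('p \<Rightarrow> 'p) \<times> ('l \<Rightarrow> 'l)) set \<Rightarrow> 'l \<Rightarrow> (('p \<Rightarrow> 'p) \<times> ('l \<Rightarrow> 'l)) set" where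
  "line_stabilizer H l = {h\<in>H. snd h l = l}"

text \<open>Elementary abelian: abelian and of prime exponent (the trivial group included).\<close>
definition elementary_abelian :: "(('p \<Rightarrow> 'p) \<times> ('l \<Rightarrow> 'l)) set \<Rightarrow> bool" where
  "elementary_abelian G \<longleftrightarrow> (\<forall>g\<in>G. \<forall>h\<in>G. aut_comp g h = aut_comp h g) \<and>
     (\<exists>p::nat. prime p \<and> (\<forall>g\<in>G. aut_pow g p = aut_id))"

end

(* Write A and B for the stabilizers of two lines L0 and L through a far point, and S for the group
   of symmetries.  Property ( * ) makes the stabilizers of the points proj_L0 x and proj_L x normal
   in H; they meet in S, so [A, B] lies in S, and H = B S A.  A variant of Benson's fixed line
   argument, with |A| = s a prime power, shows that every element of A S outside S fixes a line not
   through x, so the H-class of each nontrivial a in A is the full coset S a.  By counting, S and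
   hence H are p-groups.  If b in B commutes with a, then S = [a, S B] is contained in the commutator
   subgroup of the p-group S C(b), hence in its Frattini subgroup, so that S C(b) = C(b): b
   centralizes S and therefore fixes every line through proj_L x, as S permutes those other than
   x proj_L x transitively.  The class of a has t elements, so a is centralized by at least s/t
   elements of B. *)
theory Submission
  imports Defs "Jordan_Normal_Form.Schur_Decomposition"
    "HOL-Algebra.Group_Action" "HOL-Algebra.Sylow" "HOL-Algebra.Multiplicative_Group" "HOL-Algebra.Zassenhaus"
begin

text \<open>The inequality t < s, which the symmetries force once s and t differ, feeds both
  arithmetical steps. If an element of A S outside S, fixing the foot of L0, fixed no line off x, a
  trace would make s + t a divisor of s^2; for a prime power s this contradicts s < s + t < 2 s. And
  because A is larger than S, distinct elements of A cannot all conjugate a given element of S to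
  distinct elements; this ties the primes dividing t to the centralizer orders s^2. The centralizer
  C(b) is enlarged to S C(b) before commutators are taken because an equation u = [g, a] with g in H
  says nothing about C(b) by itself. When g is written through H = B S A, its A-part drops out as A
  is abelian, and its B-part commutes with b as B is abelian; what remains is a commutator of a with
  an element of S, and both of these lie in S C(b).\<close>

hide_const (open) Polynomial.order Matrix.col

section \<open>Traces of matrices of finite order\<close>

lemma algebraic_int_sum_list_roots_of_unity:
  fixes es :: "complex list"
  assumes n: "n > 0" and es: "\<And>e. e \<in> set es \<Longrightarrow> e = 0 \<or> e ^ n = 1"
  shows "algebraic_int (sum_list es)"
proof -
  have fin: "finite {z::complex. z ^ n = 1}"
    using finite_roots_unity[of n] n by simp
  then obtain us where us: "set us = {z::complex. z ^ n = 1}" "distinct us"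
    using finite_distinct_list by blast
  define m where "m = length us"
  define c where "c u v = length (filter (\<lambda>e. e * u = v) es)" for u v :: complex
  \<comment> \<open>multiplication by the sum acts on the roots of unity through this integer matrix\<close>
  define C :: "int mat" where "C = mat m m (\<lambda>(i,j). int (c (us ! i) (us ! j)))"
  define v where "v = vec_of_list us"
  have C: "C \<in> carrier_mat m m" by (simp add: C_def)
  have C': "map_mat complex_of_int C \<in> carrier_mat m m" using C by simp
  \<comment> \<open>Row \<open>u\<close> of the eigenvector equation: a root of unity
    \<open>e\<close> in \<open>es\<close> is counted at exactly one column, e u, while e = 0 is
    counted at no column and adds nothing on the right either.\<close>
  have key: "(\<Sum>w\<in>{z. z ^ n = 1}. of_nat (c u w) * w) = sum_list es * u" if "u ^ n = 1" for u
    using es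
  proof (unfold c_def, induction es)
    case Nil
    then show ?case by simp
  next
    case (Cons e es)
    have IH: "(\<Sum>w\<in>{z. z ^ n = 1}. of_nat (length (filter (\<lambda>e. e * u = w) es)) * w) = sum_list es * u"
      using Cons by simp
    have "(\<Sum>w\<in>{z. z ^ n = 1}. of_nat (length (filter (\<lambda>e. e * u = w) (e # es))) * w)
      = (\<Sum>w\<in>{z. z ^ n = 1}. (if w = e * u then w else 0)) + sum_list es * u"
      unfolding IH[symmetric] sum.distrib[symmetric]
      by (rule sum.cong) (auto simp: algebra_simps)
    also have "(\<Sum>w\<in>{z. z ^ n = 1}. (if w = e * u then w else 0)) = e * u"
      using Cons.prems[of e] that fin n by (auto simp: sum.delta power_mult_distrib)
    finally show ?case by (simp add: algebra_simps)
  qed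
  have "eigenvector (map_mat complex_of_int C) v (sum_list es)"
    unfolding eigenvector_def
  proof (intro conjI)
    show "v \<in> carrier_vec (dim_row (map_mat complex_of_int C))"
      using C unfolding v_def m_def by (auto intro: carrier_vecI)
    have "1 \<in> set us" using us by simp
    then obtain i where i: "i < m" "us ! i = 1" unfolding m_def by (auto simp: in_set_conv_nth)
    show "v \<noteq> 0\<^sub>v (dim_row (map_mat complex_of_int C))"
    proof
      assume "v = 0\<^sub>v (dim_row (map_mat complex_of_int C))"
      then have "v $ i = 0" using i C by simp
      then show False using i by (simp add: v_def vec_of_list_index)
    qed
    show "map_mat complex_of_int C *\<^sub>v v = sum_list es \<cdot>\<^sub>v v"
    proof (rule eq_vecI)
      fix i assume "i < dim_vec (sum_list es \<cdot>\<^sub>v v)"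
      then have i: "i < m" by (simp add: v_def m_def)
      then have ui: "(us ! i) ^ n = 1" using us unfolding m_def using nth_mem by blast
      have "(map_mat complex_of_int C *\<^sub>v v) $ i = (\<Sum>j<m. of_nat (c (us ! i) (us ! j)) * us ! j)"
        using i by (auto simp: C_def v_def m_def scalar_prod_def vec_of_list_index lessThan_atLeast0 intro!: sum.cong)
      also have "\<dots> = (\<Sum>w\<in>{z. z ^ n = 1}. of_nat (c (us ! i) w) * w)"
        unfolding us(1)[symmetric] m_def
        by (rule sum.reindex_bij_betw[OF bij_betw_nth[OF us(2) refl refl]])
      also have "\<dots> = sum_list es * (us ! i)" by (rule key[OF ui])
      finally show "(map_mat complex_of_int C *\<^sub>v v) $ i = (sum_list es \<cdot>\<^sub>v v) $ i"
        using i by (simp add: v_def m_def vec_of_list_index)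
    qed (simp add: v_def C_def m_def)
  qed
  then have "eigenvalue (map_mat complex_of_int C) (sum_list es)"
    unfolding eigenvalue_def by blast
  then have "poly (char_poly (map_mat complex_of_int C)) (sum_list es) = 0"
    using eigenvalue_root_char_poly[OF C'] by simp
  then have "poly (map_poly of_int (char_poly C)) (sum_list es) = 0"
    by (simp add: of_int_hom.char_poly_hom[OF C])
  moreover have "lead_coeff (char_poly C) = 1"
    using degree_monic_char_poly[OF C] by simp
  ultimately show ?thesis unfolding algebraic_int_altdef_ipoly by blast
qed

text \<open>The equation A^(n+1) = A, unlike A^n = 1, leaves room for the eigenvalue 0; all others
  are n-th roots of unity. After Schur triangularization the trace is the sum of the diagonal, since
  P B Q and Q P B have the same trace.\<close>

lemma algebraic_int_trace_finite_order:
  fixes A :: "complex mat"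
  assumes A: "A \<in> carrier_mat m m" and n: "n > 0" and pow: "A ^\<^sub>m Suc n = A"
  shows "algebraic_int (\<Sum>i<m. A $$ (i,i))"
proof -
  obtain as where "char_poly A = (\<Prod> a \<leftarrow> as. [:- a, 1:])"
    using char_poly_factorized[OF A] by blast
  then obtain B where B: "B \<in> carrier_mat m m" "upper_triangular B" and sim: "similar_mat A B"
    using schur_decomposition_exists[OF A] by blast
  then obtain P Q where "similar_mat_wit A B P Q" unfolding similar_mat_def by blast
  from similar_mat_witD2[OF A this]
  have PQ: "P \<in> carrier_mat m m" "Q \<in> carrier_mat m m" "Q * P = 1\<^sub>m m" "A = P * B * Q" by auto
  have tr_mult: "(\<Sum>i<m. (R * W) $$ (i,i)) = (\<Sum>i<m. \<Sum>j<m. R $$ (i,j) * W $$ (j,i))"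
    if "R \<in> carrier_mat m m" "W \<in> carrier_mat m m" for R W :: "complex mat"
    using that by (intro sum.cong) (auto simp: scalar_prod_def lessThan_atLeast0)
  have PB: "P * B \<in> carrier_mat m m" using PQ B by simp
  have "(\<Sum>i<m. A $$ (i,i)) = (\<Sum>i<m. \<Sum>j<m. (P * B) $$ (i,j) * Q $$ (j,i))"
    unfolding PQ(4) by (rule tr_mult[OF PB PQ(2)])
  also have "\<dots> = (\<Sum>j<m. \<Sum>i<m. Q $$ (j,i) * (P * B) $$ (i,j))"
    by (subst sum.swap) (simp add: mult.commute)
  also have "\<dots> = (\<Sum>j<m. (Q * (P * B)) $$ (j,j))"
    by (rule tr_mult[OF PQ(2) PB, symmetric])
  also have "Q * (P * B) = B" using PQ B by (simp flip: assoc_mult_mat)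
  also have "(\<Sum>j<m. B $$ (j,j)) = sum_list (diag_mat B)"
    using B by (simp add: diag_mat_def interv_sum_list_conv_sum_set_nat atLeast0LessThan)
  finally have tr: "(\<Sum>i<m. A $$ (i,i)) = sum_list (diag_mat B)" .
  have "e = 0 \<or> e ^ n = 1" if e: "e \<in> set (diag_mat B)" for e
  proof -
    have "poly (char_poly B) e = 0"
      unfolding char_poly_upper_triangular[OF B] using e by (induction "diag_mat B") (auto simp: poly_prod_list prod_list_zero_iff)
    then have "eigenvalue A e"
      using eigenvalue_root_char_poly[OF A] char_poly_similar[OF sim] by simp
    then obtain v where v: "eigenvector A v e" unfolding eigenvalue_def by blast
    have "e ^ Suc n \<cdot>\<^sub>v v = e \<cdot>\<^sub>v v"
      using eigenvector_pow[OF A v, of "Suc n"] pow v unfolding eigenvector_def by simp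
    moreover obtain i where "i < m" "v $ i \<noteq> 0"
      using v A unfolding eigenvector_def by (metis carrier_matD(1) carrier_vecD eq_vecI index_zero_vec(1) index_zero_vec(2))
    moreover have "dim_vec v = m" using v A unfolding eigenvector_def by auto
    ultimately have "e ^ Suc n * v $ i = e * v $ i" by (metis index_smult_vec(1))
    then show ?thesis using \<open>v $ i \<noteq> 0\<close> by auto
  qed
  then show ?thesis unfolding tr by (rule algebraic_int_sum_list_roots_of_unity[OF n])
qed

text \<open>\<open>Y\<close> divided by \<open>c\<close> is idempotent and commutes with the
  permutation matrix of \<open>q\<close>, so the product T of the two satisfies T^(n+1) = T. The
  trace of T is therefore an algebraic integer; being rational it is an integer, and it equals the
  sum in question divided by \<open>c\<close>.\<close>

lemma dvd_twisted_trace: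
  fixes Y :: "'a \<Rightarrow> 'a \<Rightarrow> int" and c :: int
  assumes fin: "finite X" and q: "bij_betw q X X" and c: "c > 0"
    and sq: "\<And>u v. u \<in> X \<Longrightarrow> v \<in> X \<Longrightarrow> (\<Sum>w\<in>X. Y u w * Y w v) = c * Y u v"
    and inv: "\<And>u v. u \<in> X \<Longrightarrow> v \<in> X \<Longrightarrow> Y (q u) (q v) = Y u v"
    and n: "n > 0" and ord: "\<And>u. u \<in> X \<Longrightarrow> (q ^^ n) u = u"
  shows "c dvd (\<Sum>u\<in>X. Y u (q u))"
proof -
  obtain us where us: "set us = X" "distinct us" using fin finite_distinct_list by blast
  define m where "m = length us"
  have bij: "bij_betw (\<lambda>i. us ! i) {..<m} X"
    using bij_betw_nth[OF us(2) refl us(1)[symmetric]] unfolding m_def .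
  have mem: "us ! i \<in> X" if "i < m" for i using that us unfolding m_def by auto
  have qX: "q u \<in> X" if "u \<in> X" for u using q that by (auto simp: bij_betw_def)
  have qkX: "(q ^^ k) u \<in> X" if "u \<in> X" for u k using qX that by (induction k) auto
  have qk: "bij_betw (q ^^ k) X X" for k
    by (rule bij_betw_funpow[OF q])
  have invk: "Y ((q ^^ k) u) ((q ^^ k) v) = Y u v" if "u \<in> X" "v \<in> X" for u v k
    using that by (induction k) (auto simp: inv qkX)
  define T :: "complex mat" where "T = mat m m (\<lambda>(i,j). of_int (Y (us ! i) (q (us ! j))) / of_int c)"
  have T: "T \<in> carrier_mat m m" by (simp add: T_def)
  have Tk: "T ^\<^sub>m Suc k = mat m m (\<lambda>(i,j). of_int (Y (us ! i) ((q ^^ Suc k) (us ! j))) / of_int c)" for k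
  proof (induction k)
    case 0
    then show ?case using T by (simp add: T_def)
  next
    case (Suc k)
    have "T ^\<^sub>m Suc (Suc k) = mat m m (\<lambda>(i,j). of_int (Y (us ! i) ((q ^^ Suc k) (us ! j))) / of_int c) * T"
      using Suc by simp
    also have "\<dots> = mat m m (\<lambda>(i,j). of_int (Y (us ! i) ((q ^^ Suc (Suc k)) (us ! j))) / of_int c)"
    proof (rule eq_matI)
      fix i j assume "i < dim_row (mat m m (\<lambda>(i,j). complex_of_int (Y (us ! i) ((q ^^ Suc (Suc k)) (us ! j))) / of_int c))"
        and "j < dim_col (mat m m (\<lambda>(i,j). complex_of_int (Y (us ! i) ((q ^^ Suc (Suc k)) (us ! j))) / of_int c))"
      then have ij: "i < m" "j < m" by auto
      have "(mat m m (\<lambda>(i,j). complex_of_int (Y (us ! i) ((q ^^ Suc k) (us ! j))) / of_int c) * T) $$ (i,j)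
        = (\<Sum>l<m. of_int (Y (us ! i) ((q ^^ Suc k) (us ! l)) * Y (us ! l) (q (us ! j))) / of_int (c * c))"
        using ij by (auto simp: T_def scalar_prod_def lessThan_atLeast0 intro!: sum.cong)
      also have "\<dots> = of_int (\<Sum>l<m. Y (us ! i) ((q ^^ Suc k) (us ! l)) * Y (us ! l) (q (us ! j))) / of_int (c * c)"
        by (simp add: sum_divide_distrib)
      also have "(\<Sum>l<m. Y (us ! i) ((q ^^ Suc k) (us ! l)) * Y (us ! l) (q (us ! j)))
        = (\<Sum>w\<in>X. Y (us ! i) ((q ^^ Suc k) w) * Y w (q (us ! j)))"
        by (rule sum.reindex_bij_betw[OF bij])
      \<comment> \<open>Here the two matrices are commuted: invariance shifts the second factor by
        q^(k+1), so that the summation variable can be replaced throughout and \<open>sq\<close>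
        applies.\<close>
      also have "\<dots> = (\<Sum>w\<in>X. Y (us ! i) ((q ^^ Suc k) w) * Y ((q ^^ Suc k) w) ((q ^^ Suc k) (q (us ! j))))"
        by (intro sum.cong refl) (metis invk mem[OF ij(2)] qX)
      also have "\<dots> = (\<Sum>w\<in>X. Y (us ! i) w * Y w ((q ^^ Suc k) (q (us ! j))))"
        by (rule sum.reindex_bij_betw[OF qk])
      also have "\<dots> = c * Y (us ! i) ((q ^^ Suc k) (q (us ! j)))"
        by (rule sq[OF mem[OF ij(1)] qkX[OF qX[OF mem[OF ij(2)]]]])
      also have "(q ^^ Suc k) (q (us ! j)) = (q ^^ Suc (Suc k)) (us ! j)"
        by (simp add: funpow_swap1)
      finally show "(mat m m (\<lambda>(i,j). complex_of_int (Y (us ! i) ((q ^^ Suc k) (us ! j))) / of_int c) * T) $$ (i,j)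
        = mat m m (\<lambda>(i,j). of_int (Y (us ! i) ((q ^^ Suc (Suc k)) (us ! j))) / of_int c) $$ (i,j)"
        using ij c by simp
    qed (auto simp: T_def)
    finally show ?case .
  qed
  have "T ^\<^sub>m Suc n = T"
    by (subst Tk, unfold T_def) (rule eq_matI, auto simp: ord mem funpow_swap1 qX)
  from algebraic_int_trace_finite_order[OF T n this]
  have alg: "algebraic_int (\<Sum>i<m. T $$ (i,i))" .
  have "(\<Sum>i<m. T $$ (i,i)) = of_int (\<Sum>i<m. Y (us ! i) (q (us ! i))) / of_int c"
    by (simp add: T_def sum_divide_distrib)
  also have "(\<Sum>i<m. Y (us ! i) (q (us ! i))) = (\<Sum>u\<in>X. Y u (q u))"
    by (rule sum.reindex_bij_betw[OF bij])
  finally have eq: "(\<Sum>i<m. T $$ (i,i)) = of_int (\<Sum>u\<in>X. Y u (q u)) / of_int c" .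
  then have "(\<Sum>i<m. T $$ (i,i)) \<in> \<int>"
    using alg unfolding eq by (intro rational_algebraic_int_is_int Rats_divide Rats_of_int)
  then obtain k where "complex_of_int (\<Sum>u\<in>X. Y u (q u)) / of_int c = of_int k"
    unfolding eq by (auto elim: Ints_cases)
  then have "complex_of_int (\<Sum>u\<in>X. Y u (q u)) = of_int (c * k)"
    using c by (simp add: field_simps)
  then have "(\<Sum>u\<in>X. Y u (q u)) = c * k" using of_int_eq_iff by blast
  then show ?thesis by simp
qed

section \<open>Finite p-groups\<close>

lemma (in group) inv_mult_cancel_left:
  assumes "x \<in> carrier G" "y \<in> carrier G"
  shows "inv x \<otimes> (x \<otimes> y) = y" "x \<otimes> (inv x \<otimes> y) = y"
  using assms by (simp_all flip: m_assoc)

text \<open>The values of an action lie in \<open>BijGroup E\<close>, whose elements are extensional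
  on \<open>E\<close>; a function total on its type has to be restricted to \<open>E\<close> to
  become one.\<close>

lemma (in group) group_action_of_fun:
  assumes closed: "\<And>g e. g \<in> carrier G \<Longrightarrow> e \<in> E \<Longrightarrow> f g e \<in> E"
    and one: "\<And>e. e \<in> E \<Longrightarrow> f \<one> e = e"
    and mult: "\<And>g h e. g \<in> carrier G \<Longrightarrow> h \<in> carrier G \<Longrightarrow> e \<in> E \<Longrightarrow> f (g \<otimes> h) e = f g (f h e)"
  shows "group_action G E (\<lambda>g. \<lambda>e\<in>E. f g e)"
proof -
  have bij: "bij_betw (f g) E E" if g: "g \<in> carrier G" for g
  proof (rule bij_betwI[where g = "f (inv g)"])
    show "f (inv g) (f g e) = e" if "e \<in> E" for e
      using mult[of "inv g" g e] one[OF that] that g by simp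
    show "f g (f (inv g) e) = e" if "e \<in> E" for e
      using mult[of g "inv g" e] one[OF that] that g by simp
  qed (use g closed in auto)
  have "(\<lambda>g. \<lambda>e\<in>E. f g e) \<in> hom G (BijGroup E)"
  proof (rule homI)
    fix g assume g: "g \<in> carrier G"
    show "(\<lambda>e\<in>E. f g e) \<in> carrier (BijGroup E)"
      using bij[OF g] by (auto simp: BijGroup_def Bij_def)
    fix h assume h: "h \<in> carrier G"
    show "(\<lambda>e\<in>E. f (g \<otimes> h) e) = (\<lambda>e\<in>E. f g e) \<otimes>\<^bsub>BijGroup E\<^esub> (\<lambda>e\<in>E. f h e)"
      using bij[OF g] bij[OF h] g h closed mult
      by (auto simp: BijGroup_def Bij_def compose_def fun_eq_iff)
  qed
  then show ?thesis
    unfolding group_action_def group_hom_def group_hom_axioms_def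
    using group_BijGroup is_group by blast
qed

lemma (in group) card_orbit_of_fun:
  assumes closed: "\<And>g e. g \<in> carrier G \<Longrightarrow> e \<in> E \<Longrightarrow> f g e \<in> E"
    and one: "\<And>e. e \<in> E \<Longrightarrow> f \<one> e = e"
    and mult: "\<And>g h e. g \<in> carrier G \<Longrightarrow> h \<in> carrier G \<Longrightarrow> e \<in> E \<Longrightarrow> f (g \<otimes> h) e = f g (f h e)"
    and e: "e \<in> E"
  shows "card ((\<lambda>g. f g e) ` carrier G) * card {g \<in> carrier G. f g e = e} = order G"
    and "subgroup {g \<in> carrier G. f g e = e} G"
proof -
  interpret act: group_action G E "\<lambda>g. \<lambda>e\<in>E. f g e"
    by (rule group_action_of_fun) (fact closed one mult)+
  have "orbit G (\<lambda>g. \<lambda>e\<in>E. f g e) e = (\<lambda>g. f g e) ` carrier G"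
    unfolding orbit_def using e by auto
  moreover have st: "stabilizer G (\<lambda>g. \<lambda>e\<in>E. f g e) e = {g \<in> carrier G. f g e = e}"
    unfolding stabilizer_def using e by auto
  ultimately show "card ((\<lambda>g. f g e) ` carrier G) * card {g \<in> carrier G. f g e = e} = order G"
    using act.orbit_stabilizer_theorem[OF e] by simp
  show "subgroup {g \<in> carrier G. f g e = e} G"
    using act.stabilizer_subgroup[OF e] st by simp
qed

text \<open>Orbits have p-power size, so an orbit that is not a fixed point has size divisible by p.
  Were \<open>e0\<close> the only fixed point, the size of \<open>E\<close> would be 1 modulo
  p.\<close>

lemma (in group) p_group_second_fixed_point:
  fixes p :: nat
  assumes p: "prime p" and ord: "order G = p ^ n"
    and closed: "\<And>g e. g \<in> carrier G \<Longrightarrow> e \<in> E \<Longrightarrow> f g e \<in> E"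
    and one: "\<And>e. e \<in> E \<Longrightarrow> f \<one> e = e"
    and mult: "\<And>g h e. g \<in> carrier G \<Longrightarrow> h \<in> carrier G \<Longrightarrow> e \<in> E \<Longrightarrow> f (g \<otimes> h) e = f g (f h e)"
    and E: "finite E" "p dvd card E"
    and e0: "e0 \<in> E" "\<And>g. g \<in> carrier G \<Longrightarrow> f g e0 = e0"
  obtains e where "e \<in> E" "e \<noteq> e0" "\<And>g. g \<in> carrier G \<Longrightarrow> f g e = e"
proof -
  interpret act: group_action G E "\<lambda>g. \<lambda>e\<in>E. f g e"
    by (rule group_action_of_fun) (fact closed one mult)+
  let ?O = "orbits G E (\<lambda>g. \<lambda>e\<in>E. f g e)"
  have finO: "finite ?O"
    using E(1) act.orbits_coverture by (metis finite_UnionD)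
  have orb: "orbit G (\<lambda>g. \<lambda>e\<in>E. f g e) e = (\<lambda>g. f g e) ` carrier G" if "e \<in> E" for e
    unfolding orbit_def using that by auto
  have "{e0} \<in> ?O"
    unfolding orbits_def using e0 orb[OF e0(1)] one_closed by (auto intro!: exI[of _ e0])
  have cE: "card E = (\<Sum>B\<in>?O. card B)"
    using act.disjoint_sum[OF E(1), of "\<lambda>_. 1::nat"] by simp
  have "\<exists>e\<in>E. e \<noteq> e0 \<and> (\<forall>g\<in>carrier G. f g e = e)"
  proof (rule ccontr)
    assume none: "\<not> ?thesis"
    have "p dvd card B" if B: "B \<in> ?O - {{e0}}" for B
    proof -
      obtain e where e: "e \<in> E" "B = (\<lambda>g. f g e) ` carrier G"
        using B orb unfolding orbits_def by auto
      have "card B * card {g \<in> carrier G. f g e = e} = p ^ n"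
        unfolding e(2) ord[symmetric]
        by (rule card_orbit_of_fun(1)[where E = E and f = f]) (fact closed one mult e(1))+
      then have "card B dvd p ^ n" by (metis dvd_triv_left)
      then obtain k where k: "card B = p ^ k" using divides_primepow_nat[OF p] by blast
      have "k \<noteq> 0"
      proof
        assume "k = 0"
        then obtain b where b: "B = {b}" using k by (metis card_1_singletonE power_0)
        have "e \<in> B" using e one[OF e(1)] one_closed by (metis image_eqI)
        then have "\<forall>g\<in>carrier G. f g e = e" using b e(2) by auto
        then have "e = e0" using none e(1) by blast
        then show False using B b \<open>e \<in> B\<close> by auto
      qed
      then show ?thesis using k by simp
    qed
    then have "p dvd (\<Sum>B\<in>?O - {{e0}}. card B)" by (rule dvd_sum)
    moreover have "card E = 1 + (\<Sum>B\<in>?O - {{e0}}. card B)"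
      unfolding cE using sum.remove[OF finO \<open>{e0} \<in> ?O\<close>, of card] by simp
    ultimately have "p dvd 1" using E(2) by (metis dvd_add_left_iff)
    then show False using p by (simp add: prime_nat_iff)
  qed
  then show thesis using that by blast
qed

text \<open>\<open>K\<close> acts on its right cosets by right multiplication and fixes the coset
  \<open>K\<close>. The number of cosets is divisible by p, so a second coset K g is fixed, which
  says that g conjugates \<open>K\<close> into itself.\<close>

lemma (in group) p_group_normalizer_grows:
  fixes p :: nat
  assumes p: "prime p" and ord: "order G = p ^ n"
    and K: "subgroup K G" "K \<noteq> carrier G"
  obtains g where "g \<in> carrier G" "g \<notin> K" "\<And>k. k \<in> K \<Longrightarrow> g \<otimes> k \<otimes> inv g \<in> K"
proof -
  have pos: "order G > 0" using ord p prime_gt_0_nat by simp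
  then have fin: "finite (carrier G)" using order_gt_0_iff_finite by blast
  have KG: "K \<subseteq> carrier G" using K(1) subgroup.subset by blast
  have lag: "card (rcosets K) * card K = p ^ n" using lagrange[OF K(1)] ord by simp
  then obtain k where k: "card K = p ^ k" using divides_primepow_nat[OF p] by (metis dvd_triv_right)
  obtain j where j: "card (rcosets K) = p ^ j" using lag divides_primepow_nat[OF p] by (metis dvd_triv_left)
  have "j \<noteq> 0"
  proof
    assume "j = 0"
    then have "card K = card (carrier G)" using lag j ord by (simp add: Coset.order_def)
    then show False using K(2) KG fin card_subset_eq by blast
  qed
  interpret K: group "G\<lparr>carrier := K\<rparr>" using K(1) subgroup_imp_group by blast
  have Kin: "x \<in> carrier G" if "x \<in> K" for x using that KG by blast
  have invK: "inv x \<in> K" if "x \<in> K" for x using subgroup.m_inv_closed[OF K(1) that] .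
  have rc: "(K #> g) #> inv x = K #> (g \<otimes> inv x)" if "x \<in> K" "g \<in> carrier G" for x g
    using that Kin KG coset_mult_assoc by simp
  have sub: "e \<subseteq> carrier G" if "e \<in> rcosets K" for e
    using that KG r_coset_subset_G unfolding RCOSETS_def by blast
  \<comment> \<open>The inverse turns right multiplication into a left action.\<close>
  obtain e where e: "e \<in> rcosets K" "e \<noteq> K" "\<And>x. x \<in> K \<Longrightarrow> e #> inv x = e"
  proof (rule K.p_group_second_fixed_point[of p k "rcosets K" "\<lambda>x e. e #> inv x" K])
    show "order (G\<lparr>carrier := K\<rparr>) = p ^ k" using k by (simp add: Coset.order_def)
    show "e #> inv g \<in> rcosets K" if "g \<in> carrier (G\<lparr>carrier := K\<rparr>)" "e \<in> rcosets K" for g e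
      using that rc Kin unfolding RCOSETS_def by auto
    show "e #> inv \<one>\<^bsub>G\<lparr>carrier := K\<rparr>\<^esub> = e" if "e \<in> rcosets K" for e
      using sub[OF that] by (simp add: coset_mult_one)
    show "e #> inv (g \<otimes>\<^bsub>G\<lparr>carrier := K\<rparr>\<^esub> h) = e #> inv h #> inv g"
      if "g \<in> carrier (G\<lparr>carrier := K\<rparr>)" "h \<in> carrier (G\<lparr>carrier := K\<rparr>)" "e \<in> rcosets K" for g h e
      using that sub[OF that(3)] Kin by (simp add: inv_mult_group coset_mult_assoc)
    show "finite (rcosets K)" using fin unfolding RCOSETS_def by simp
    show "p dvd card (rcosets K)" using j \<open>j \<noteq> 0\<close> by simp
    show "K \<in> rcosets K" using K(1) by (metis coset_join2 one_closed rcosetsI subgroup.one_closed KG)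
    show "K #> inv g = K" if "g \<in> carrier (G\<lparr>carrier := K\<rparr>)" for g
      using that K(1) Kin invK by (simp add: coset_join2)
  qed (use p in auto)
  obtain g where g: "g \<in> carrier G" "e = K #> g" using e(1) unfolding RCOSETS_def by blast
  have "g \<notin> K" using e(2) g K(1) coset_join2 by blast
  moreover have "g \<otimes> x \<otimes> inv g \<in> K" if x: "x \<in> K" for x
  proof -
    have "K #> (g \<otimes> x) = K #> g" using e(3)[OF invK[OF x]] rc[OF invK[OF x] g(1)] g x Kin by simp
    then have "g \<otimes> x \<in> K #> g" using rcos_self[OF m_closed[OF g(1) Kin[OF x]] K(1)] by simp
    then obtain y where "y \<in> K" "g \<otimes> x = y \<otimes> g" unfolding r_coset_def by auto
    then show ?thesis using g Kin by (simp add: m_assoc)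
  qed
  ultimately show thesis using that g(1) by blast
qed

text \<open>The inverse of g is the power of g with exponent the group order minus one, so closure
  under products suffices.\<close>

lemma (in group) subgroup_of_finite:
  assumes "finite (carrier G)" "T \<subseteq> carrier G" "\<one> \<in> T" "\<And>g h. g \<in> T \<Longrightarrow> h \<in> T \<Longrightarrow> g \<otimes> h \<in> T"
  shows "subgroup T G"
proof (rule subgroupI)
  fix g assume g: "g \<in> T"
  have pow: "g [^] k \<in> T" for k :: nat
    using g assms by (induction k) auto
  have "g [^] (order G - 1) \<otimes> g = \<one>"
    using g assms pow_order_eq_1[of g] by (metis One_nat_def Suc_diff_1 nat_pow_Suc order_gt_0_iff_finite subsetD)
  then have "inv g = g [^] (order G - 1)"
    using g assms(2) by (metis inv_unique' inv_equality nat_pow_closed subsetD)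
  then show "inv g \<in> T" using pow by simp
qed (use assms in auto)

text \<open>Maximal subgroups of a finite p-group are normal with abelian quotient.\<close>
lemma (in group) p_group_proper_subgroup_commutators:
  fixes p :: nat
  assumes p: "prime p" and ord: "order G = p ^ n"
    and C: "subgroup C G" "C \<noteq> carrier G"
  obtains K where "subgroup K G" "C \<subseteq> K" "K \<noteq> carrier G"
    "\<And>g h. g \<in> carrier G \<Longrightarrow> h \<in> carrier G \<Longrightarrow> g \<otimes> h \<otimes> inv g \<otimes> inv h \<in> K"
proof -
  have pos: "order G > 0" using ord p prime_gt_0_nat by simp
  then have fin: "finite (carrier G)" using order_gt_0_iff_finite by blast
  define F where "F = {K. subgroup K G \<and> C \<subseteq> K \<and> K \<noteq> carrier G}"
  have "finite F" unfolding F_def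
    by (rule finite_subset[of _ "Pow (carrier G)"]) (use fin subgroup.subset in auto)
  moreover have "C \<in> F" using C unfolding F_def by blast
  ultimately obtain K where K: "K \<in> F" and "C \<subseteq> K" and max: "\<And>L. L \<in> F \<Longrightarrow> K \<subseteq> L \<Longrightarrow> L = K"
    using finite_has_maximal2[of F C] by metis
  have KG: "subgroup K G" "C \<subseteq> K" "K \<noteq> carrier G" using K unfolding F_def by auto
  then have sub: "K \<subseteq> carrier G" using subgroup.subset by blast
  \<comment> \<open>\<open>K\<close> is maximal in the whole group, not merely in \<open>F\<close>:
    a subgroup above \<open>K\<close> contains \<open>C\<close> as well.\<close>
  have big: "L = carrier G" if "subgroup L G" "K \<subseteq> L" "g \<in> L" "g \<notin> K" for L g
    using max[of L] that KG unfolding F_def by blast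
  obtain g0 where g0: "g0 \<in> carrier G" "g0 \<notin> K" "\<And>k. k \<in> K \<Longrightarrow> g0 \<otimes> k \<otimes> inv g0 \<in> K"
    using p_group_normalizer_grows[OF p ord KG(1,3)] by blast
  \<comment> \<open>The normalizer of \<open>K\<close>; by \<open>g0\<close> it is strictly larger
    than \<open>K\<close>, hence everything, and \<open>K\<close> is normal.\<close>
  define N where "N = {g \<in> carrier G. \<forall>k\<in>K. g \<otimes> k \<otimes> inv g \<in> K}"
  have "subgroup N G"
  proof (rule subgroup_of_finite[OF fin])
    show "\<one> \<in> N" using sub unfolding N_def by auto
    fix g h assume gh: "g \<in> N" "h \<in> N"
    have "(g \<otimes> h) \<otimes> k \<otimes> inv (g \<otimes> h) = g \<otimes> (h \<otimes> k \<otimes> inv h) \<otimes> inv g" if "k \<in> K" for k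
      using gh that sub unfolding N_def by (auto simp: inv_mult_group m_assoc)
    then show "g \<otimes> h \<in> N" using gh unfolding N_def by auto
  qed (auto simp: N_def)
  moreover have "K \<subseteq> N" using KG(1) sub unfolding N_def
    by (auto intro!: subgroup.m_closed subgroup.m_inv_closed)
  moreover have "g0 \<in> N" using g0 unfolding N_def by auto
  ultimately have "N = carrier G" using big g0(2) by blast
  then have norm: "g \<otimes> k \<otimes> inv g \<in> K" if "g \<in> carrier G" "k \<in> K" for g k
    using that unfolding N_def by blast
  have com: "g \<otimes> h \<otimes> inv g \<otimes> inv h \<in> K" if g: "g \<in> carrier G" and h: "h \<in> carrier G" for g h
  proof (cases "g \<in> K")
    case True
    have "h \<otimes> inv g \<otimes> inv h \<in> K" by (rule norm[OF h subgroup.m_inv_closed[OF KG(1) True]])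
    then have "g \<otimes> (h \<otimes> inv g \<otimes> inv h) \<in> K" by (rule subgroup.m_closed[OF KG(1) True])
    then show ?thesis using g h by (simp add: m_assoc)
  next
    case False
    \<comment> \<open>For fixed \<open>g\<close> outside \<open>K\<close>, the elements whose
      commutator with \<open>g\<close> lies in \<open>K\<close> form a subgroup, because [g, a b] =
      [g, a] (a [g, b] a^-1) and \<open>K\<close> is normal. It contains \<open>K\<close> and
      \<open>g\<close>, so maximality makes it the whole group; the quotient never has to be
      formed.\<close>
    define L where "L = {h \<in> carrier G. g \<otimes> h \<otimes> inv g \<otimes> inv h \<in> K}"
    have "subgroup L G"
    proof (rule subgroup_of_finite[OF fin])
      show "\<one> \<in> L" using g KG(1) subgroup.one_closed unfolding L_def by auto
      fix a b assume ab: "a \<in> L" "b \<in> L"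
      then have "g \<otimes> a \<otimes> inv g \<otimes> inv a \<otimes> (a \<otimes> (g \<otimes> b \<otimes> inv g \<otimes> inv b) \<otimes> inv a) \<in> K"
        using norm KG(1) unfolding L_def by (blast intro: subgroup.m_closed)
      moreover have "g \<otimes> a \<otimes> inv g \<otimes> inv a \<otimes> (a \<otimes> (g \<otimes> b \<otimes> inv g \<otimes> inv b) \<otimes> inv a)
        = g \<otimes> (a \<otimes> b) \<otimes> inv g \<otimes> inv (a \<otimes> b)"
        using ab g unfolding L_def by (simp add: m_assoc inv_mult_group inv_mult_cancel_left)
      ultimately show "a \<otimes> b \<in> L" using ab unfolding L_def by auto
    qed (auto simp: L_def)
    moreover have "K \<subseteq> L"
    proof
      fix k assume k: "k \<in> K"
      have "g \<otimes> k \<otimes> inv g \<otimes> inv k \<in> K"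
        using norm[OF g k] k KG(1) by (blast intro: subgroup.m_closed subgroup.m_inv_closed)
      then show "k \<in> L" using k sub unfolding L_def by auto
    qed
    moreover have "g \<in> L" using g KG(1) subgroup.one_closed unfolding L_def by (auto simp: m_assoc)
    ultimately have "L = carrier G" using big False by blast
    then show ?thesis using h unfolding L_def by blast
  qed
  show thesis using that KG com by blast
qed


section \<open>The group-theoretic core: factorizations G = B S A with S normal\<close>

lemma prime_powerI:
  fixes p t :: nat
  assumes p: "prime p" and t: "t > 0" and only: "\<And>r. prime r \<Longrightarrow> r dvd t \<Longrightarrow> r = p"
  obtains f where "t = p ^ f"
proof -
  obtain m where m: "t = p ^ multiplicity p t * m" "\<not> p dvd m"
    using multiplicity_decompose'[of t p] t p by (metis neq0_conv not_prime_unit)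
  have "m = 1"
  proof (rule ccontr)
    assume "m \<noteq> 1"
    then obtain r where "prime r" "r dvd m" using prime_factor_nat by blast
    then show False using only[of r] m by (metis dvd_mult)
  qed
  then show thesis using m that by simp
qed

lemma (in group) ord_dvd_card_subgroup:
  assumes "subgroup T G" "finite T" "g \<in> T"
  shows "ord g dvd card T"
proof -
  interpret T: group "G\<lparr>carrier := T\<rparr>" using assms(1) subgroup_imp_group by blast
  have "g [^]\<^bsub>G\<lparr>carrier := T\<rparr>\<^esub> card T = \<one>"
    using T.pow_order_eq_1[of g] assms by (simp add: Coset.order_def)
  then have "g [^] card T = \<one>" by (simp flip: nat_pow_consistent)
  then show ?thesis using assms subgroup.subset pow_eq_id by blast
qed

lemma (in group) mem_centralizer_conj:
  assumes "x \<in> carrier G" "g \<in> carrier G"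
  shows "g \<otimes> x \<otimes> inv g = x \<longleftrightarrow> g \<otimes> x = x \<otimes> g"
  using assms by (metis inv_closed inv_solve_right m_closed)

lemma (in group) conj_action:
  assumes "x \<in> carrier G" "g \<in> carrier G" "h \<in> carrier G"
  shows "(g \<otimes> h) \<otimes> x \<otimes> inv (g \<otimes> h) = g \<otimes> (h \<otimes> x \<otimes> inv h) \<otimes> inv g"
  using assms by (simp add: inv_mult_group m_assoc)

text \<open>Modulo \<open>S\<close> the subgroup \<open>A\<close> is abelian and commutes with
  \<open>B\<close>; as G = B S A, the image of \<open>A\<close> in the quotient by \<open>S\<close>
  is central.\<close>

lemma (in group) conj_mem_normal_coset:
  assumes S: "S \<lhd> G" and A: "subgroup A G" "\<And>a a'. a \<in> A \<Longrightarrow> a' \<in> A \<Longrightarrow> a \<otimes> a' = a' \<otimes> a"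
    and B: "B \<subseteq> carrier G"
    and comm: "\<And>a b. a \<in> A \<Longrightarrow> b \<in> B \<Longrightarrow> b \<otimes> a \<otimes> inv b \<otimes> inv a \<in> S"
    and fact: "\<And>g. g \<in> carrier G \<Longrightarrow> \<exists>b\<in>B. \<exists>u\<in>S. \<exists>a\<in>A. g = b \<otimes> u \<otimes> a"
    and a: "a \<in> A" and gG: "g \<in> carrier G"
  obtains u where "u \<in> S" "g \<otimes> a \<otimes> inv g = u \<otimes> a"
proof -
  have subS: "subgroup S G" using S normal_imp_subgroup by blast
  have AG: "a \<in> carrier G" if "a \<in> A" for a using that A(1) subgroup.subset by blast
  have BG: "b \<in> carrier G" if "b \<in> B" for b using that B by blast
  have SG: "u \<in> carrier G" if "u \<in> S" for u using that subS subgroup.subset by blast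
  have Sconj: "g \<otimes> u \<otimes> inv g \<in> S" if "g \<in> carrier G" "u \<in> S" for g u
    using S that by (rule normal.inv_op_closed2)
  note Smult = subgroup.m_closed[OF subS] and Sinv = subgroup.m_inv_closed[OF subS]
  obtain b u a' where g: "b \<in> B" "u \<in> S" "a' \<in> A" "g = b \<otimes> u \<otimes> a'" using fact[OF gG] by blast
  have "a' \<otimes> a \<otimes> inv a' = a" using mem_centralizer_conj[OF AG[OF a] AG[OF g(3)]] A(2)[OF g(3) a] by simp
  then have "g \<otimes> a \<otimes> inv g = b \<otimes> (u \<otimes> a \<otimes> inv u) \<otimes> inv b"
    using g a AG BG SG by (simp add: conj_action)
  also have "\<dots> = (b \<otimes> (u \<otimes> (a \<otimes> inv u \<otimes> inv a)) \<otimes> inv b) \<otimes> (b \<otimes> a \<otimes> inv b \<otimes> inv a) \<otimes> a"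
    using g a AG BG SG by (simp add: m_assoc inv_mult_cancel_left)
  finally have eq: "g \<otimes> a \<otimes> inv g = \<dots>" .
  have "u \<otimes> (a \<otimes> inv u \<otimes> inv a) \<in> S"
    by (rule Smult[OF g(2) Sconj[OF AG[OF a] Sinv[OF g(2)]]])
  then have "(b \<otimes> (u \<otimes> (a \<otimes> inv u \<otimes> inv a)) \<otimes> inv b) \<otimes> (b \<otimes> a \<otimes> inv b \<otimes> inv a) \<in> S"
    by (rule Smult[OF Sconj[OF BG[OF g(1)]] comm[OF a g(1)]])
  then show thesis using that eq by blast
qed

text \<open>The theorem freed from geometry. \<open>fuse\<close> and the preceding lemma make the
  class of each nontrivial a in \<open>A\<close> exactly the coset S a, so the centralizer of a has
  order s^2. The bound counts the elements of \<open>B\<close> commuting with one such a, each of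
  which turns out to centralize \<open>S\<close>.\<close>

lemma (in group) centralizer_of_normal_factor:
  fixes p e s t :: nat
  assumes p: "prime p" and s: "s = p ^ e" and ord: "order G = s * s * t" and t0: "t > 0" and ts: "t < s"
    and S: "S \<lhd> G" "card S = t"
    and A: "subgroup A G" "card A = s" "\<And>a a'. a \<in> A \<Longrightarrow> a' \<in> A \<Longrightarrow> a \<otimes> a' = a' \<otimes> a"
    and B: "subgroup B G" "card B = s" "\<And>b b'. b \<in> B \<Longrightarrow> b' \<in> B \<Longrightarrow> b \<otimes> b' = b' \<otimes> b"
    and comm: "\<And>a b. a \<in> A \<Longrightarrow> b \<in> B \<Longrightarrow> b \<otimes> a \<otimes> inv b \<otimes> inv a \<in> S"
    and fact: "\<And>g. g \<in> carrier G \<Longrightarrow> \<exists>b\<in>B. \<exists>u\<in>S. \<exists>a\<in>A. g = b \<otimes> u \<otimes> a"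
    and fuse: "\<And>a u. a \<in> A \<Longrightarrow> a \<noteq> \<one> \<Longrightarrow> u \<in> S \<Longrightarrow> \<exists>g\<in>carrier G. g \<otimes> a \<otimes> inv g = u \<otimes> a"
  shows "s \<le> t * card {b \<in> B. \<forall>u\<in>S. b \<otimes> u = u \<otimes> b}"
proof -
  have subS: "subgroup S G" using S(1) normal_imp_subgroup by blast
  have fins: "s > 0" using ts by simp
  then have finA: "finite A" and finB: "finite B" using A(2) B(2) card_ge_0_finite by force+
  have AG: "a \<in> carrier G" if "a \<in> A" for a using that A(1) subgroup.subset by blast
  have BG: "b \<in> carrier G" if "b \<in> B" for b using that B(1) subgroup.subset by blast
  have SG: "u \<in> carrier G" if "u \<in> S" for u using that subS subgroup.subset by blast
  have Sconj: "g \<otimes> u \<otimes> inv g \<in> S" if "g \<in> carrier G" "u \<in> S" for g u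
    using S(1) that by (rule normal.inv_op_closed2)
  define C where "C x = {g \<in> carrier G. g \<otimes> x \<otimes> inv g = x}" for x
  have conj1: "x \<in> carrier G \<Longrightarrow> \<one> \<otimes> x \<otimes> inv \<one> = x" for x by simp
  have orbC: "card ((\<lambda>g. g \<otimes> x \<otimes> inv g) ` carrier G) * card (C x) = order G"
    and subC: "subgroup (C x) G" if "x \<in> carrier G" for x
    using card_orbit_of_fun[of "carrier G" "\<lambda>g x. g \<otimes> x \<otimes> inv g" x] that conj1 conj_action
    unfolding C_def by auto
  have Cmem: "g \<in> C x \<longleftrightarrow> g \<otimes> x = x \<otimes> g" if "x \<in> carrier G" "g \<in> carrier G" for x g
    unfolding C_def using that mem_centralizer_conj by auto
  have cls: "(\<lambda>g. g \<otimes> a \<otimes> inv g) ` carrier G = (\<lambda>u. u \<otimes> a) ` S" if a: "a \<in> A" "a \<noteq> \<one>" for a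
  proof
    show "(\<lambda>u. u \<otimes> a) ` S \<subseteq> (\<lambda>g. g \<otimes> a \<otimes> inv g) ` carrier G"
    proof (rule image_subsetI)
      fix u assume "u \<in> S"
      then obtain g where "g \<in> carrier G" "g \<otimes> a \<otimes> inv g = u \<otimes> a" using fuse[OF a] by blast
      then show "u \<otimes> a \<in> (\<lambda>g. g \<otimes> a \<otimes> inv g) ` carrier G" by force
    qed
    show "(\<lambda>g. g \<otimes> a \<otimes> inv g) ` carrier G \<subseteq> (\<lambda>u. u \<otimes> a) ` S"
    proof (rule image_subsetI)
      fix g assume "g \<in> carrier G"
      then obtain u where "u \<in> S" "g \<otimes> a \<otimes> inv g = u \<otimes> a"
        using conj_mem_normal_coset[OF S(1) A(1,3) subgroup.subset[OF B(1)] comm fact a(1)] by blast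
      then show "g \<otimes> a \<otimes> inv g \<in> (\<lambda>u. u \<otimes> a) ` S" by blast
    qed
  qed
  have finS: "finite S" using S(2) t0 card_ge_0_finite by blast
  have cardcls: "card ((\<lambda>u. u \<otimes> a) ` S) = t" if "a \<in> A" for a
    using that AG SG S(2) by (subst card_image) (auto intro!: inj_onI)
  have cardC: "card (C a) = s * s" if "a \<in> A" "a \<noteq> \<one>" for a
    using orbC[OF AG[OF that(1)]] unfolding cls[OF that] cardcls[OF that(1)] ord using t0 by simp
  \<comment> \<open>A subgroup of \<open>S\<close> of order r supplies an element u of order r.
    Conjugating u by the s > t elements of \<open>A\<close> yields at most t results, so some
    nontrivial a in \<open>A\<close> commutes with u. Then r divides the order s^2 of the
    centralizer of a.\<close>
  have only: "r = p" if r: "prime r" "r dvd t" for r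
  proof -
    interpret S: group "G\<lparr>carrier := S\<rparr>" using subS subgroup_imp_group by blast
    obtain m where m: "t = r ^ 1 * m" using r by auto
    obtain R where R: "subgroup R (G\<lparr>carrier := S\<rparr>)" "card R = r ^ 1"
      using sylow_thm[OF r(1) S.is_group, of 1 m] m S(2) finS by (auto simp: Coset.order_def)
    then have RG: "subgroup R G" using subS incl_subgroup by blast
    have RS: "R \<subseteq> S" using subgroup.subset[OF R(1)] by simp
    have finR: "finite R" using RS finS finite_subset by blast
    have "\<not> R \<subseteq> {\<one>}"
      using R(2) r(1) card_mono[of "{\<one>}" R] prime_gt_1_nat[OF r(1)] by auto
    then obtain u where u: "u \<in> R" "u \<noteq> \<one>" by blast
    have uS: "u \<in> S" and uG: "u \<in> carrier G" using u RS SG by auto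
    have "\<not> inj_on (\<lambda>a. a \<otimes> u \<otimes> inv a) A"
    proof
      assume "inj_on (\<lambda>a. a \<otimes> u \<otimes> inv a) A"
      moreover have "(\<lambda>a. a \<otimes> u \<otimes> inv a) ` A \<subseteq> S" using Sconj AG uS by blast
      ultimately have "s \<le> t" using card_inj_on_le[of _ A S] finS A(2) S(2) by auto
      then show False using ts by simp
    qed
    then obtain a1 a2 where a12: "a1 \<in> A" "a2 \<in> A" "a1 \<noteq> a2" "a1 \<otimes> u \<otimes> inv a1 = a2 \<otimes> u \<otimes> inv a2"
      unfolding inj_on_def by blast
    define a where "a = inv a2 \<otimes> a1"
    have a: "a \<in> A" unfolding a_def
      using a12 by (intro subgroup.m_closed[OF A(1)] subgroup.m_inv_closed[OF A(1)])
    have "a \<noteq> \<one>" using a12 AG unfolding a_def by (metis inv_closed inv_equality inv_inv)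
    have "a \<otimes> u \<otimes> inv a = inv a2 \<otimes> (a1 \<otimes> u \<otimes> inv a1) \<otimes> inv (inv a2)"
      unfolding a_def using a12 AG uG by (intro conj_action) auto
    also have "\<dots> = u" unfolding a12(4) using a12 AG uG by (simp add: m_assoc inv_mult_cancel_left)
    finally have "a \<otimes> u = u \<otimes> a" using mem_centralizer_conj[OF uG AG[OF a]] by simp
    then have "u \<in> C a" using Cmem[OF AG[OF a] uG] by simp
    then have "ord u dvd s * s"
      using ord_dvd_card_subgroup[OF subC[OF AG[OF a]]] cardC[OF a \<open>a \<noteq> \<one>\<close>] fins card_ge_0_finite
      by (metis mult_pos_pos)
    moreover have "ord u dvd r" using ord_dvd_card_subgroup[OF RG finR u(1)] R(2) by simp
    moreover have "ord u \<noteq> 1" using ord_eq_1[OF uG] u by simp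
    ultimately have "r dvd p ^ (e + e)" using r(1) s by (metis power_add prime_nat_iff)
    then show ?thesis using r(1) p prime_dvd_power primes_dvd_imp_eq by blast
  qed
  obtain f where f: "t = p ^ f" using prime_powerI[OF p t0 only] by blast
  have ordp: "order G = p ^ (e + e + f)" unfolding ord s f by (simp add: power_add)
  obtain a where a: "a \<in> A" "a \<noteq> \<one>"
  proof -
    have "\<not> A \<subseteq> {\<one>}" using A(2) ts t0 card_mono[of "{\<one>}" A] by auto
    then show thesis using that by blast
  qed
  note aG = AG[OF a(1)]
  \<comment> \<open>\<open>S\<close> lies in the commutator subgroup of the p-group \<open>T = S C(b)\<close>, so \<open>T = C(b)\<close>.\<close>
  have cent: "b \<otimes> u = u \<otimes> b" if b: "b \<in> B" "b \<otimes> a = a \<otimes> b" and u: "u \<in> S" for b u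
  proof -
    note bG = BG[OF b(1)]
    note sC = subC[OF bG]
    define T where "T = S <#> C b"
    have T: "subgroup T G" unfolding T_def by (rule mult_norm_subgroup[OF S(1) sC])
    have oC: "\<one> \<in> C b" and oS: "\<one> \<in> S" using subgroup.one_closed[OF sC] subgroup.one_closed[OF subS] .
    have CG: "c \<in> carrier G" if "c \<in> C b" for c using that unfolding C_def by simp
    have CT: "C b \<subseteq> T"
    proof
      fix c assume c: "c \<in> C b"
      then have "\<one> \<otimes> c \<in> T" unfolding T_def using oS set_mult_def by fast
      then show "c \<in> T" using CG[OF c] by simp
    qed
    have ST: "S \<subseteq> T"
    proof
      fix c assume c: "c \<in> S"
      then have "c \<otimes> \<one> \<in> T" unfolding T_def using oC set_mult_def by fast
      then show "c \<in> T" using SG[OF c] by simp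
    qed
    interpret T: group "G\<lparr>carrier := T\<rparr>" using T subgroup_imp_group by blast
    have TG: "g \<in> carrier G" if "g \<in> T" for g using that subgroup.subset[OF T] by blast
    have "card T dvd p ^ (e + e + f)" using lagrange[OF T] ordp by (metis dvd_triv_right)
    then obtain k where k: "order (G\<lparr>carrier := T\<rparr>) = p ^ k"
      using divides_primepow_nat[OF p] by (auto simp: Coset.order_def)
    have subCT: "subgroup (C b) (G\<lparr>carrier := T\<rparr>)" using subgroup_incl[OF sC T CT] .
    have "C b = T"
    proof (rule ccontr)
      assume "C b \<noteq> T"
      then have ne: "C b \<noteq> carrier (G\<lparr>carrier := T\<rparr>)" by simp
      obtain K where K: "subgroup K (G\<lparr>carrier := T\<rparr>)" "C b \<subseteq> K" "K \<noteq> T"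
        "\<And>g h. g \<in> T \<Longrightarrow> h \<in> T \<Longrightarrow> g \<otimes> h \<otimes> inv g \<otimes> inv h \<in> K"
      proof (rule T.p_group_proper_subgroup_commutators[OF p k subCT ne])
        fix K assume K: "subgroup K (G\<lparr>carrier := T\<rparr>)" "C b \<subseteq> K" "K \<noteq> carrier (G\<lparr>carrier := T\<rparr>)"
          "\<And>g h. g \<in> carrier (G\<lparr>carrier := T\<rparr>) \<Longrightarrow> h \<in> carrier (G\<lparr>carrier := T\<rparr>) \<Longrightarrow>
            g \<otimes>\<^bsub>G\<lparr>carrier := T\<rparr>\<^esub> h \<otimes>\<^bsub>G\<lparr>carrier := T\<rparr>\<^esub> inv\<^bsub>G\<lparr>carrier := T\<rparr>\<^esub> g \<otimes>\<^bsub>G\<lparr>carrier := T\<rparr>\<^esub> inv\<^bsub>G\<lparr>carrier := T\<rparr>\<^esub> h \<in> K"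
        have "g \<otimes> h \<otimes> inv g \<otimes> inv h \<in> K" if "g \<in> T" "h \<in> T" for g h
          using K(4)[of g h] that m_inv_consistent[OF T] by simp
        then show thesis using that K by simp
      qed
      have KG: "subgroup K G" using incl_subgroup[OF T K(1)] .
      note Kmult = subgroup.m_closed[OF KG] and Kinv = subgroup.m_inv_closed[OF KG]
      have aC: "a \<in> C b" using Cmem[OF bG aG] b(2) by simp
      have "u' \<in> K" if u': "u' \<in> S" for u'
      proof -
        obtain g where g: "g \<in> carrier G" "g \<otimes> a \<otimes> inv g = u' \<otimes> a" using fuse[OF a u'] by blast
        obtain b' v a' where bva: "b' \<in> B" "v \<in> S" "a' \<in> A" "g = b' \<otimes> v \<otimes> a'" using fact[OF g(1)] by blast
        have "a' \<otimes> a \<otimes> inv a' = a" using mem_centralizer_conj[OF aG AG[OF bva(3)]] A(3)[OF bva(3) a(1)] by simp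
        then have "u' \<otimes> a = b' \<otimes> (v \<otimes> a \<otimes> inv v) \<otimes> inv b'"
          unfolding g(2)[symmetric] using bva a AG BG SG by (simp add: conj_action)
        \<comment> \<open>The regrouping isolates the commutator of v and a, both elements of
          \<open>T\<close>; the other factors, b' and a conjugate of its inverse by a, lie in the
          centralizer of b and hence in \<open>K\<close>.\<close>
        also have "\<dots> = (b' \<otimes> (v \<otimes> a \<otimes> inv v \<otimes> inv a) \<otimes> (a \<otimes> inv b' \<otimes> inv a)) \<otimes> a"
          using bva a AG BG SG by (simp add: m_assoc inv_mult_cancel_left)
        finally have eq: "u' = b' \<otimes> (v \<otimes> a \<otimes> inv v \<otimes> inv a) \<otimes> (a \<otimes> inv b' \<otimes> inv a)"
          using bva aG BG SG u' by (subst (asm) right_cancel) auto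
        have b'K: "b' \<in> K" using Cmem[OF bG BG[OF bva(1)]] B(3)[OF bva(1) b(1)] K(2) by auto
        have aK: "a \<in> K" using aC K(2) by auto
        have "v \<otimes> a \<otimes> inv v \<otimes> inv a \<in> K" using K(4) bva(2) ST aC CT by blast
        then show ?thesis unfolding eq
          using Kmult[OF Kmult[OF b'K] Kmult[OF Kmult[OF aK Kinv[OF b'K]] Kinv[OF aK]]] by simp
      qed
      then have "T \<subseteq> K" using K(2) Kmult unfolding T_def set_mult_def by blast
      then show False using K(3) subgroup.subset[OF K(1)] by simp
    qed
    then have "u \<in> C b" using ST u by blast
    then show ?thesis using Cmem[OF bG SG[OF u]] by simp
  qed
  \<comment> \<open>The centralizer of \<open>a\<close> in \<open>B\<close>. The orbit of
    \<open>a\<close> under \<open>B\<close> stays inside S a, so it has at most t elements and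
    \<open>D\<close> has index at most t in \<open>B\<close>.\<close>
  define D where "D = {b \<in> B. b \<otimes> a \<otimes> inv b = a}"
  interpret B: group "G\<lparr>carrier := B\<rparr>" using B(1) subgroup_imp_group by blast
  have "card ((\<lambda>b. b \<otimes> a \<otimes> inv b) ` B) * card D = s"
    using B.card_orbit_of_fun(1)[of "carrier G" "\<lambda>g x. g \<otimes> x \<otimes> inv g" a] BG aG conj1 conj_action B(2)
    unfolding D_def by (simp add: Coset.order_def)
  moreover have "card ((\<lambda>b. b \<otimes> a \<otimes> inv b) ` B) \<le> t"
  proof -
    have "(\<lambda>b. b \<otimes> a \<otimes> inv b) ` B \<subseteq> (\<lambda>u. u \<otimes> a) ` S" unfolding cls[OF a, symmetric] using BG by blast
    then have "card ((\<lambda>b. b \<otimes> a \<otimes> inv b) ` B) \<le> card ((\<lambda>u. u \<otimes> a) ` S)"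
      using finS by (intro card_mono) auto
    then show ?thesis using cardcls[OF a(1)] by simp
  qed
  ultimately have "s \<le> t * card D" by (metis mult_le_mono1)
  also have "card D \<le> card {b \<in> B. \<forall>u\<in>S. b \<otimes> u = u \<otimes> b}"
  proof (rule card_mono)
    show "D \<subseteq> {b \<in> B. \<forall>u\<in>S. b \<otimes> u = u \<otimes> b}"
      unfolding D_def using cent mem_centralizer_conj[OF aG BG] by blast
  qed (use finB in auto)
  finally show ?thesis by (simp add: mult_le_mono2)
qed


text \<open>Each prime r dividing the order gives an element of order r, and the exponent p forces r
  = p.\<close>

lemma (in group) order_prime_power_of_exponent:
  fixes p :: nat
  assumes fin: "finite (carrier G)" and p: "prime p" and ex: "\<And>g. g \<in> carrier G \<Longrightarrow> g [^] p = \<one>"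
  obtains e where "order G = p ^ e"
proof -
  have pos: "order G > 0" using fin order_gt_0_iff_finite by simp
  have "r = p" if r: "prime r" "r dvd order G" for r
  proof -
    obtain m where m: "order G = r ^ 1 * m" using r(2) by (metis dvdE power_one_right)
    obtain R where R: "subgroup R G" "card R = r ^ 1"
      using sylow_thm[OF r(1) is_group m fin] by blast
    have finR: "finite R" using fin subgroup.subset[OF R(1)] finite_subset by blast
    have "\<not> R \<subseteq> {\<one>}"
      using R(2) r(1) card_mono[of "{\<one>}" R] prime_gt_1_nat[OF r(1)] by auto
    then obtain u where u: "u \<in> R" "u \<noteq> \<one>" by blast
    have uG: "u \<in> carrier G" using u subgroup.subset[OF R(1)] by blast
    have "ord u dvd r" using ord_dvd_card_subgroup[OF R(1) finR u(1)] R(2) by simp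
    moreover have "ord u dvd p" using pow_eq_id[OF uG] ex[OF uG] by simp
    moreover have "ord u \<noteq> 1" using ord_eq_1[OF uG] u by simp
    ultimately have "ord u = r" "ord u = p" using r(1) p unfolding prime_nat_iff by blast+
    then show ?thesis by simp
  qed
  then show thesis using prime_powerI[OF p pos] that by blast
qed

section \<open>The concurrency matrix of a generalized quadrangle\<close>

locale gq =
  fixes P :: "'p set" and Ls :: "'l set" and I :: "'p \<Rightarrow> 'l \<Rightarrow> bool" and s t :: nat and x :: 'p
  assumes gq: "finite_GQ P Ls I s t" and xP: "x \<in> P" and s1: "s > 1" and t1: "t > 1"
begin

abbreviation "col \<equiv> collinear Ls I"
text \<open>Together with x itself, the far and the near points exhaust \<open>P\<close>. A line of
  \<open>X\<close> carries exactly one near point, its foot, and s far ones.\<close>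

definition "far = far_points P Ls I x"
definition "near u \<longleftrightarrow> u \<in> P \<and> u \<noteq> x \<and> col x u"
definition "X = {l \<in> Ls. \<not> I x l}"
definition "foot l = proj P Ls I l x"

section \<open>Incidence geometry and counting around the point x\<close>

lemma finP: "finite P" and finL: "finite Ls"
  using gq unfolding finite_GQ_def by auto

lemma card_points: "l \<in> Ls \<Longrightarrow> card {p \<in> P. I p l} = s + 1"
  and card_lines: "p \<in> P \<Longrightarrow> card {l \<in> Ls. I p l} = t + 1"
  using gq unfolding finite_GQ_def by auto

lemma line_unique:
  assumes "p \<in> P" "q \<in> P" "p \<noteq> q" "l \<in> Ls" "m \<in> Ls" "I p l" "I q l" "I p m" "I q m"
  shows "l = m"
proof -
  have "card {l \<in> Ls. I p l \<and> I q l} \<le> 1" using gq assms unfolding finite_GQ_def by blast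
  then show ?thesis using finL assms by (auto simp: card_le_Suc0_iff_eq)
qed

lemma proj_ex: "p \<in> P \<Longrightarrow> l \<in> Ls \<Longrightarrow> \<not> I p l \<Longrightarrow> \<exists>q\<in>P. I q l \<and> col p q"
  using gq unfolding finite_GQ_def by blast

lemma proj_unique:
  "p \<in> P \<Longrightarrow> l \<in> Ls \<Longrightarrow> \<not> I p l \<Longrightarrow> q \<in> P \<Longrightarrow> r \<in> P \<Longrightarrow> I q l \<Longrightarrow> I r l \<Longrightarrow> col p q \<Longrightarrow> col p r \<Longrightarrow> q = r"
  using gq unfolding finite_GQ_def by blast

lemma colI: "l \<in> Ls \<Longrightarrow> I p l \<Longrightarrow> I q l \<Longrightarrow> col p q"
  unfolding collinear_def by blast

lemma col_sym: "col p q \<Longrightarrow> col q p"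
  unfolding collinear_def by blast

lemma ex_line: "p \<in> P \<Longrightarrow> \<exists>l\<in>Ls. I p l"
  using card_lines[of p] by (metis (no_types, lifting) Collect_empty_eq add_is_0 card.empty zero_neq_one)

lemma col_refl: "p \<in> P \<Longrightarrow> col p p"
  using ex_line colI by blast

lemma far_iff: "z \<in> far \<longleftrightarrow> z \<in> P \<and> \<not> col x z"
  unfolding far_def far_points_def using col_refl[OF xP] by auto

lemma farP: "z \<in> far \<Longrightarrow> z \<in> P" and nearP: "near u \<Longrightarrow> u \<in> P"
  unfolding far_iff near_def by auto

lemma fin_far: "finite far" and fin_X: "finite X"
  using finP finL finite_subset[of far P] far_iff unfolding X_def by auto

lemma XL: "l \<in> X \<Longrightarrow> l \<in> Ls" and X_not: "l \<in> X \<Longrightarrow> \<not> I x l"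
  unfolding X_def by auto

lemma far_line: "z \<in> far \<Longrightarrow> l \<in> Ls \<Longrightarrow> I z l \<Longrightarrow> l \<in> X"
  unfolding far_iff X_def using colI by blast

lemma foot:
  assumes "l \<in> X"
  shows "near (foot l)" "I (foot l) l"
proof -
  have "\<exists>!q. q \<in> P \<and> I q l \<and> col x q"
    using assms gq xP unfolding finite_GQ_def X_def by blast
  from theI'[OF this] have "foot l \<in> P \<and> I (foot l) l \<and> col x (foot l)"
    unfolding foot_def proj_def .
  then show "near (foot l)" "I (foot l) l" using assms unfolding near_def X_def by auto
qed

lemma foot_eq: "l \<in> X \<Longrightarrow> near u \<Longrightarrow> I u l \<Longrightarrow> foot l = u"
  using foot[of l] proj_unique[OF xP XL X_not, of l "foot l" u] unfolding near_def by blast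

lemma on_X: "l \<in> X \<Longrightarrow> p \<in> P \<Longrightarrow> I p l \<Longrightarrow> p \<noteq> foot l \<Longrightarrow> p \<in> far"
  using foot_eq[of l p] X_not unfolding far_iff near_def by blast

lemma foot_not_far: "l \<in> X \<Longrightarrow> foot l \<notin> far"
  using foot(1) unfolding far_iff near_def by blast

lemma near_neq_far: "near u \<Longrightarrow> z \<in> far \<Longrightarrow> u \<noteq> z"
  unfolding far_iff near_def by blast

lemma axis:
  assumes "near u"
  obtains m where "m \<in> Ls" "I x m" "I u m" "\<And>l. l \<in> Ls \<Longrightarrow> I u l \<Longrightarrow> l = m \<or> l \<in> X"
proof -
  obtain m where m: "m \<in> Ls" "I x m" "I u m" using assms unfolding near_def collinear_def by blast
  have "l = m" if "l \<in> Ls" "I u l" "l \<notin> X" for l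
    using line_unique[of x u l m] that m assms xP unfolding near_def X_def by blast
  then show thesis using that m by blast
qed

lemma near_colE:
  assumes "near u" "near v" "col u v"
  obtains m where "m \<in> Ls" "I x m" "I u m" "I v m"
proof (cases "u = v")
  case True
  then show thesis using axis[OF assms(1)] that by blast
next
  case False
  obtain l where l: "l \<in> Ls" "I u l" "I v l" using assms(3) unfolding collinear_def by blast
  have "l \<notin> X" using False foot_eq[OF _ assms(1) l(2)] foot_eq[OF _ assms(2) l(3)] by blast
  then show thesis using that l unfolding X_def by blast
qed

text \<open>On near points collinearity is an equivalence relation, its classes being the lines
  through x with x removed.\<close>

lemma near_col_trans:
  assumes "near u" "near v" "near w" "col u v" "col v w"
  shows "col u w"
proof -
  obtain m where m: "m \<in> Ls" "I x m" "I u m" "I v m" using near_colE[OF assms(1,2,4)] .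
  obtain m' where m': "m' \<in> Ls" "I x m'" "I v m'" "I w m'" using near_colE[OF assms(2,3,5)] .
  have "m = m'" using line_unique[of x v m m'] m m' assms(2) xP unfolding near_def by blast
  then show ?thesis using m m' colI by blast
qed

text \<open>A far point is not on the line through x, u and v, so only one point of that line is
  collinear with it. Most uniqueness arguments below go through this absence of triangles.\<close>

lemma triangle:
  assumes "near u" "near v" "col u v" "z \<in> far" "col z u" "col z v"
  shows "u = v"
proof -
  obtain m where m: "m \<in> Ls" "I x m" "I u m" "I v m" using near_colE[OF assms(1-3)] .
  have "\<not> I z m" using m assms(4) colI unfolding far_iff by blast
  then show ?thesis using proj_unique[OF farP m(1)] m assms nearP by blast
qed

lemma far_near_line:
  assumes "z \<in> far" "near u" "col z u"
  obtains l where "l \<in> X" "I z l" "foot l = u"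
proof -
  obtain l where l: "l \<in> Ls" "I z l" "I u l" using assms(3) unfolding collinear_def by blast
  then show thesis using that far_line[OF assms(1)] foot_eq[OF _ assms(2)] by blast
qed

lemma far_foot: "z \<in> far \<Longrightarrow> l \<in> X \<Longrightarrow> I z l \<Longrightarrow> col z (foot l)"
  using foot(2) XL colI by blast

lemma X_eqI: "l \<in> X \<Longrightarrow> l' \<in> X \<Longrightarrow> z \<in> far \<Longrightarrow> I z l \<Longrightarrow> I z l' \<Longrightarrow> foot l = foot l' \<Longrightarrow> l = l'"
  using line_unique[of z "foot l" l l'] foot[of l] foot[of l'] near_neq_far[of "foot l" z] farP nearP XL by metis

lemma feet_not_col:
  assumes "l \<in> X" "l' \<in> X" "l \<noteq> l'" "z \<in> far" "I z l" "I z l'"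
  shows "\<not> col (foot l) (foot l')"
  using triangle[OF foot(1)[OF assms(1)] foot(1)[OF assms(2)] _ assms(4)] far_foot assms X_eqI by metis

lemma far_proj:
  assumes "l \<in> X" "near u" "\<not> col u (foot l)"
  shows "\<exists>z\<in>far. I z l \<and> col z u"
proof -
  have "\<not> I u l" using assms foot(2) XL colI by blast
  then obtain z where "z \<in> P" "I z l" "col u z" using proj_ex[OF nearP XL] assms by blast
  then show ?thesis using assms on_X[OF assms(1)] col_sym by metis
qed

lemma card_far_on: "l \<in> X \<Longrightarrow> card {z \<in> far. I z l} = s"
proof -
  assume l: "l \<in> X"
  have "{p \<in> P. I p l} = insert (foot l) {z \<in> far. I z l}"
    using on_X[OF l] foot[OF l] nearP far_iff by auto
  then have "card (insert (foot l) {z \<in> far. I z l}) = s + 1" using card_points[OF XL[OF l]] by simp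
  then show ?thesis using foot_not_far[OF l] fin_far by simp
qed

lemma card_X_through_far: "z \<in> far \<Longrightarrow> card {l \<in> X. I z l} = t + 1"
proof -
  assume z: "z \<in> far"
  have "{l \<in> X. I z l} = {l \<in> Ls. I z l}" using far_line[OF z] XL by blast
  then show ?thesis using card_lines[OF farP[OF z]] by simp
qed

lemma card_foot_eq: "near u \<Longrightarrow> card {l \<in> X. foot l = u} = t"
proof -
  assume u: "near u"
  obtain m where m: "m \<in> Ls" "I x m" "I u m" "\<And>l. l \<in> Ls \<Longrightarrow> I u l \<Longrightarrow> l = m \<or> l \<in> X" using axis[OF u] by metis
  have "{l \<in> Ls. I u l} = insert m {l \<in> X. foot l = u}"
    using m foot_eq[OF _ u] foot(2) XL by auto
  then have "card (insert m {l \<in> X. foot l = u}) = t + 1" using card_lines[OF nearP[OF u]] by simp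
  then show ?thesis using m(2) X_not fin_X by (subst (asm) card_insert_disjoint) auto
qed

lemma fin_near: "finite {v. near v \<and> Q v}"
  by (rule finite_subset[OF _ finP]) (auto simp: near_def)

lemma card_near_col: "near u \<Longrightarrow> card {v. near v \<and> col v u} = s"
proof -
  assume u: "near u"
  obtain m where m: "m \<in> Ls" "I x m" "I u m" using axis[OF u] by metis
  have "{p \<in> P. I p m} = insert x {v. near v \<and> col v u}"
  proof (intro equalityI subsetI)
    fix p assume p: "p \<in> {p \<in> P. I p m}"
    then show "p \<in> insert x {v. near v \<and> col v u}" using m colI unfolding near_def by blast
  next
    fix p assume p: "p \<in> insert x {v. near v \<and> col v u}"
    show "p \<in> {p \<in> P. I p m}"
    proof (cases "p = x")
      case False
      then have v: "near p" "col p u" using p by auto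
      obtain m' where m': "m' \<in> Ls" "I x m'" "I p m'" "I u m'" using near_colE[OF v(1) u v(2)] .
      have "m' = m" using line_unique[of x u m' m] m m' u xP unfolding near_def by blast
      then show ?thesis using m' nearP[OF v(1)] by simp
    qed (use m xP in simp)
  qed
  then have "card (insert x {v. near v \<and> col v u}) = s + 1" using card_points[OF m(1)] by simp
  then show ?thesis using fin_near[of "\<lambda>v. col v u"] by (subst (asm) card_insert_disjoint) (auto simp: near_def)
qed

lemma card_feet_col: "near u \<Longrightarrow> card {l \<in> X. col (foot l) u} = s * t"
proof -
  assume u: "near u"
  have eq: "{l \<in> X. col (foot l) u} = (\<Union>v\<in>{v. near v \<and> col v u}. {l \<in> X. foot l = v})"
    using foot(1) by auto
  have "card {l \<in> X. col (foot l) u} = (\<Sum>v\<in>{v. near v \<and> col v u}. card {l \<in> X. foot l = v})"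
    unfolding eq
  proof (rule card_UN_disjoint)
    show "finite {v. near v \<and> col v u}" by (rule fin_near)
    show "\<forall>v\<in>{v. near v \<and> col v u}. finite {l \<in> X. foot l = v}" using fin_X by simp
  qed blast
  also have "\<dots> = (\<Sum>v\<in>{v. near v \<and> col v u}. t)"
  proof (rule sum.cong[OF refl])
    fix v assume "v \<in> {v. near v \<and> col v u}"
    then show "card {l \<in> X. foot l = v} = t" using card_foot_eq by blast
  qed
  also have "\<dots> = s * t" using card_near_col[OF u] by simp
  finally show ?thesis .
qed

text \<open>Fix a line m through x. A far point is collinear with exactly one point of m, hence lies
  on exactly one of the s t lines of \<open>X\<close> whose foot is on m; each of these carries s
  far points.\<close>

lemma card_far: "card far = s * s * t"
proof -
  obtain m where m: "m \<in> Ls" "I x m" using ex_line[OF xP] by blast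
  have "\<not> {p \<in> P. I p m} \<subseteq> {x}"
    using card_points[OF m(1)] s1 card_mono[of "{x}" "{p \<in> P. I p m}"] by auto
  then obtain u where "u \<in> P" "I u m" "u \<noteq> x" by blast
  then have u: "near u" "I u m" using m colI unfolding near_def by blast+
  have eq: "far = (\<Union>l\<in>{l \<in> X. col (foot l) u}. {z \<in> far. I z l})"
  proof (intro equalityI subsetI)
    fix z assume z: "z \<in> far"
    have "\<not> I z m" using z m colI unfolding far_iff by blast
    then obtain v where v: "v \<in> P" "I v m" "col z v" using proj_ex[OF farP[OF z] m(1)] by blast
    then have nv: "near v" using z m colI col_sym unfolding near_def far_iff by blast
    obtain l where l: "l \<in> X" "I z l" "foot l = v" using far_near_line[OF z nv v(3)] .
    have "col v u" using v u m colI by blast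
    then show "z \<in> (\<Union>l\<in>{l \<in> X. col (foot l) u}. {z \<in> far. I z l})" using l z by blast
  qed auto
  have "card far = (\<Sum>l\<in>{l \<in> X. col (foot l) u}. card {z \<in> far. I z l})"
  proof (subst eq, rule card_UN_disjoint)
    show "\<forall>l\<in>{l \<in> X. col (foot l) u}. \<forall>l'\<in>{l \<in> X. col (foot l) u}. l \<noteq> l' \<longrightarrow>
      {z \<in> far. I z l} \<inter> {z \<in> far. I z l'} = {}"
    proof (intro ballI impI equals0I)
      fix l l' z assume l: "l \<in> {l \<in> X. col (foot l) u}" "l' \<in> {l \<in> X. col (foot l) u}" "l \<noteq> l'"
        and z: "z \<in> {z \<in> far. I z l} \<inter> {z \<in> far. I z l'}"
      have "col (foot l) (foot l')"
        using near_col_trans[OF foot(1) u(1) foot(1)] l col_sym by blast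
      then show False using feet_not_col[of l l' z] l z by blast
    qed
  qed (use fin_X fin_far in auto)
  also have "\<dots> = (\<Sum>l\<in>{l \<in> X. col (foot l) u}. s)" by (rule sum.cong[OF refl]) (simp add: card_far_on)
  also have "\<dots> = s * s * t" using card_feet_col[OF u(1)] by simp
  finally show ?thesis .
qed

section \<open>Matrices indexed by the lines not through x\<close>

text \<open>With \<open>B\<close> the incidence matrix of far points against lines of
  \<open>X\<close>, \<open>M\<close> is B^T B, with s on the diagonal, and \<open>R\<close> is the
  matrix of having the same foot. \<open>K\<close> is the product M R, given here by a direct count
  of its entries.\<close>

definition "M N N' = int (card {z \<in> far. I z N \<and> I z N'})"
definition "R N N' = (of_bool (foot N = foot N') :: int)"
definition "K N N' = int (card {z \<in> far. I z N \<and> col z (foot N')})"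
definition "B z N = (of_bool (I z N) :: int)"

text \<open>The value 0 comes from the absence of triangles; in the last case the one point counted
  is the projection of \<open>foot N'\<close> onto \<open>N\<close>. The values reveal that
  \<open>K\<close> is symmetric, which its definition hides.\<close>

lemma K_val:
  assumes "N \<in> X" "N' \<in> X"
  shows "K N N' = (if foot N = foot N' then int s else if col (foot N) (foot N') then 0 else 1)"
proof -
  consider (same) "foot N = foot N'" | (col) "foot N \<noteq> foot N'" "col (foot N) (foot N')"
    | (far) "foot N \<noteq> foot N'" "\<not> col (foot N) (foot N')" by blast
  then show ?thesis
  proof cases
    case same
    have e: "{z \<in> far. I z N \<and> col z (foot N')} = {z \<in> far. I z N}"
      using far_foot[of _ N] assms same by auto
    show ?thesis using same card_far_on assms unfolding K_def e by simp
  next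
    case col
    have e: "{z \<in> far. I z N \<and> col z (foot N')} = {}"
      using triangle[OF foot(1)[OF assms(1)] foot(1)[OF assms(2)] col(2)] far_foot[of _ N] assms(1) col(1) by auto
    show ?thesis using col unfolding K_def e by simp
  next
    case far
    have nc: "\<not> col (foot N') (foot N)" using far(2) col_sym by blast
    obtain z where z: "z \<in> far" "I z N" "col z (foot N')"
      using far_proj[OF assms(1) foot(1)[OF assms(2)] nc] by blast
    have "\<not> I (foot N') N" using nc foot(2) assms colI XL by blast
    then have e: "{z \<in> far. I z N \<and> col z (foot N')} = {z}"
      using z proj_unique[OF nearP[OF foot(1)[OF assms(2)]] XL[OF assms(1)]] farP col_sym by blast
    show ?thesis using far unfolding K_def e by simp
  qed
qed

lemma K_sym: "N \<in> X \<Longrightarrow> N' \<in> X \<Longrightarrow> K N N' = K N' N"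
  using col_sym by (auto simp: K_val)

lemma M_sym: "M N N' = M N' N"
  unfolding M_def by (simp add: conj_commute)

lemma sum_of_bool_card: "finite A \<Longrightarrow> (\<Sum>a\<in>A. (of_bool (Q a) :: int)) = int (card {a \<in> A. Q a})"
  by (simp add: of_bool_def sum.If_cases Int_def)

lemma M_sum: "M N N' = (\<Sum>z\<in>far. B z N * B z N')"
  unfolding M_def B_def by (simp add: sum_of_bool_card[OF fin_far] flip: of_bool_conj)

lemma R_row: "N' \<in> X \<Longrightarrow> (\<Sum>W\<in>X. R W N') = int t"
  unfolding R_def using sum_of_bool_card[OF fin_X, of "\<lambda>W. foot W = foot N'"] card_foot_eq[OF foot(1)] by simp

text \<open>A far point collinear with a near point u lies on exactly one line with foot u, and a
  far point not collinear with u lies on none.\<close>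

lemma MR: "N' \<in> X \<Longrightarrow> (\<Sum>W\<in>X. M N W * R W N') = K N N'"
proof -
  assume N': "N' \<in> X"
  have inner: "(\<Sum>W\<in>X. B z W * R W N') = of_bool (col z (foot N'))" if z: "z \<in> far" for z
  proof -
    have "(\<Sum>W\<in>X. B z W * R W N') = int (card {W \<in> X. I z W \<and> foot W = foot N'})"
      unfolding B_def R_def by (simp add: sum_of_bool_card[OF fin_X] flip: of_bool_conj)
    also have "\<dots> = of_bool (col z (foot N'))"
    proof (cases "col z (foot N')")
      case True
      obtain l where l: "l \<in> X" "I z l" "foot l = foot N'" using far_near_line[OF z foot(1)[OF N'] True] .
      have "W = l" if "W \<in> X" "I z W" "foot W = foot N'" for W
        using X_eqI[OF that(1) l(1) z that(2) l(2)] that(3) l(3) by simp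
      then have e: "{W \<in> X. I z W \<and> foot W = foot N'} = {l}" using l by blast
      show ?thesis using True unfolding e by simp
    next
      case False
      have "foot W \<noteq> foot N'" if "W \<in> X" "I z W" for W
        using far_foot[OF z that] False by metis
      then have e: "{W \<in> X. I z W \<and> foot W = foot N'} = {}" by blast
      show ?thesis using False unfolding e by simp
    qed
    finally show ?thesis .
  qed
  have "(\<Sum>W\<in>X. M N W * R W N') = (\<Sum>W\<in>X. \<Sum>z\<in>far. B z N * (B z W * R W N'))"
    unfolding M_sum by (simp add: sum_distrib_right mult.assoc)
  also have "\<dots> = (\<Sum>z\<in>far. B z N * (\<Sum>W\<in>X. B z W * R W N'))"
    by (subst sum.swap) (simp add: sum_distrib_left)
  also have "\<dots> = (\<Sum>z\<in>far. of_bool (I z N \<and> col z (foot N')))"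
    by (rule sum.cong[OF refl]) (simp only: inner, simp add: B_def)
  also have "\<dots> = K N N'" unfolding K_def by (rule sum_of_bool_card[OF fin_far])
  finally show ?thesis .
qed

lemma common_lines:
  assumes "z \<in> far" "w \<in> far"
  shows "(\<Sum>W\<in>X. B z W * B w W) = (if z = w then int t + 1 else of_bool (col z w))"
proof -
  have "(\<Sum>W\<in>X. B z W * B w W) = int (card {W \<in> X. I z W \<and> I w W})"
    unfolding B_def by (simp add: sum_of_bool_card[OF fin_X] flip: of_bool_conj)
  also have "\<dots> = (if z = w then int t + 1 else of_bool (col z w))"
  proof (cases "z = w")
    case True
    then show ?thesis using card_X_through_far[OF assms(1)] by simp
  next
    case False
    show ?thesis
    proof (cases "col z w")
      case True
      then obtain l where l: "l \<in> Ls" "I z l" "I w l" unfolding collinear_def by blast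
      then have e: "{W \<in> X. I z W \<and> I w W} = {l}"
        using line_unique[OF farP farP False, of _ l] assms far_line[OF assms(1)] XL by blast
      show ?thesis using True False unfolding e by simp
    next
      case False
      then have e: "{W \<in> X. I z W \<and> I w W} = {}" using colI XL by blast
      show ?thesis using False \<open>z \<noteq> w\<close> unfolding e by simp
    qed
  qed
  finally show ?thesis .
qed

text \<open>A row of B^T B B^T. If w is on \<open>N\<close>, it shares a line with each of the s far
  points there, and the point z = w contributes t further lines. If w is off \<open>N\<close>, it is
  collinear with one point of \<open>N\<close>, which counts unless it is the foot.\<close>

lemma line_sum:
  assumes N: "N \<in> X" and w: "w \<in> far"
  shows "(\<Sum>z\<in>far. B z N * (\<Sum>W\<in>X. B z W * B w W)) = int (s + t) * B w N + 1 - of_bool (col w (foot N))"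
proof -
  have "(\<Sum>z\<in>far. B z N * (\<Sum>W\<in>X. B z W * B w W))
    = (\<Sum>z\<in>far. of_bool (I z N \<and> col z w) + of_bool (z = w \<and> I w N) * int t)"
    using w by (intro sum.cong refl) (simp only: common_lines, auto simp: B_def col_refl[OF farP])
  also have "\<dots> = int (card {z \<in> far. I z N \<and> col z w}) + (\<Sum>z\<in>far. if z = w then of_bool (I w N) * int t else 0)"
    unfolding sum.distrib sum_of_bool_card[OF fin_far] by (intro arg_cong2[of _ _ _ _ "(+)"] sum.cong) auto
  also have "(\<Sum>z\<in>far. if z = w then of_bool (I w N) * int t else 0) = of_bool (I w N) * int t"
    using w fin_far by simp
  also have "int (card {z \<in> far. I z N \<and> col z w}) = int s * B w N + 1 - of_bool (col w (foot N))"
  proof (cases "I w N")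
    case True
    then have e: "{z \<in> far. I z N \<and> col z w} = {z \<in> far. I z N}" using colI XL[OF N] by blast
    show ?thesis using True far_foot[OF w N] card_far_on[OF N] unfolding e by (simp add: B_def)
  next
    case False
    obtain z where z: "z \<in> P" "I z N" "col w z" using proj_ex[OF farP[OF w] XL[OF N] False] by blast
    have un: "z' = z" if "z' \<in> P" "I z' N" "col w z'" for z'
      using proj_unique[OF farP[OF w] XL[OF N] False] z that by blast
    show ?thesis
    proof (cases "col w (foot N)")
      case True
      then have "z = foot N" using un[of "foot N"] foot[OF N] nearP by blast
      then have e: "{z \<in> far. I z N \<and> col z w} = {}"
        using un foot_not_far[OF N] farP col_sym by blast
      show ?thesis using True False unfolding e by (simp add: B_def)
    next
      case nc: False
      then have "z \<in> far" using on_X[OF N z(1,2)] z(3) by blast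
      then have e: "{z \<in> far. I z N \<and> col z w} = {z}" using un z farP col_sym by blast
      show ?thesis using nc False unfolding e by (simp add: B_def)
    qed
  qed
  finally show ?thesis by (simp add: B_def algebra_simps)
qed

lemma MM:
  assumes "N \<in> X" "N' \<in> X"
  shows "(\<Sum>W\<in>X. M N W * M W N') = int (s + t) * M N N' + int s - K N' N"
proof -
  have "(\<Sum>W\<in>X. M N W * M W N') = (\<Sum>W\<in>X. \<Sum>w\<in>far. \<Sum>z\<in>far. B w N' * (B z N * (B z W * B w W)))"
    unfolding M_sum by (simp add: sum_distrib_left sum_distrib_right mult_ac)
  also have "\<dots> = (\<Sum>w\<in>far. \<Sum>z\<in>far. \<Sum>W\<in>X. B w N' * (B z N * (B z W * B w W)))"
    by (subst sum.swap) (rule sum.cong[OF refl], rule sum.swap)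
  also have "\<dots> = (\<Sum>w\<in>far. B w N' * (\<Sum>z\<in>far. B z N * (\<Sum>W\<in>X. B z W * B w W)))"
    by (simp add: sum_distrib_left)
  also have "\<dots> = (\<Sum>w\<in>far. B w N' * (int (s + t) * B w N + 1 - of_bool (col w (foot N))))"
    by (intro sum.cong) (auto simp: line_sum[OF assms(1)])
  also have "\<dots> = (\<Sum>w\<in>far. int (s + t) * (B w N * B w N') + of_bool (I w N') - of_bool (I w N' \<and> col w (foot N)))"
    by (intro sum.cong) (auto simp: B_def)
  also have "\<dots> = int (s + t) * M N N' + int s - K N' N"
    unfolding sum.distrib sum_subtractf M_sum K_def
    by (simp add: sum_of_bool_card[OF fin_far] card_far_on[OF assms(2)] sum_distrib_left)
  finally show ?thesis .
qed

lemma KR: "N \<in> X \<Longrightarrow> (\<Sum>W\<in>X. K V W * R W N) = int t * K V N"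
proof -
  assume N: "N \<in> X"
  have "(\<Sum>W\<in>X. K V W * R W N) = (\<Sum>W\<in>X. K V N * R W N)"
    by (intro sum.cong) (auto simp: K_def R_def)
  then show ?thesis using R_row[OF N] by (simp add: mult.commute flip: sum_distrib_left)
qed

text \<open>With J the all-one matrix, M^2 = (s + t) M + s J - K. Multiplying by \<open>R\<close> on
  the right, where M R = K, J R = t J and K R = t K, gives M K; K M and K^2 follow by transposition
  and one more multiplication by \<open>R\<close>.\<close>

lemma MK:
  assumes "N \<in> X" "N' \<in> X"
  shows "(\<Sum>W\<in>X. M N W * K W N') = int s * K N N' + int s * int t"
proof -
  have "(\<Sum>W\<in>X. M N W * K W N') = (\<Sum>W\<in>X. \<Sum>V\<in>X. M N W * M W V * R V N')"
    by (simp add: sum_distrib_left mult.assoc flip: MR[OF assms(2)])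
  also have "\<dots> = (\<Sum>V\<in>X. (\<Sum>W\<in>X. M N W * M W V) * R V N')"
    by (subst sum.swap) (simp add: sum_distrib_right)
  also have "\<dots> = (\<Sum>V\<in>X. int (s + t) * (M N V * R V N') + int s * R V N' - K N V * R V N')"
    by (intro sum.cong refl)
      (simp only: MM[OF assms(1)] K_sym[OF _ assms(1)], simp add: algebra_simps)
  also have "\<dots> = int (s + t) * K N N' + int s * int t - int t * K N N'"
    unfolding sum.distrib sum_subtractf
    by (simp add: MR[OF assms(2)] R_row[OF assms(2)] KR[OF assms(2)] flip: sum_distrib_left)
  finally show ?thesis by (simp add: algebra_simps)
qed

lemma KM:
  assumes "N \<in> X" "N' \<in> X"
  shows "(\<Sum>W\<in>X. K N W * M W N') = int s * K N N' + int s * int t"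
proof -
  have "(\<Sum>W\<in>X. K N W * M W N') = (\<Sum>W\<in>X. M N' W * K W N)"
    using assms K_sym M_sym by (intro sum.cong) (auto simp: mult.commute)
  then show ?thesis using MK[OF assms(2,1)] K_sym[OF assms] by simp
qed

lemma KK:
  assumes "N \<in> X" "N' \<in> X"
  shows "(\<Sum>W\<in>X. K N W * K W N') = int s * int t * K N N' + int s * int t * int t"
proof -
  have "(\<Sum>W\<in>X. K N W * K W N') = (\<Sum>W\<in>X. \<Sum>V\<in>X. K N W * M W V * R V N')"
    by (simp add: sum_distrib_left mult.assoc flip: MR[OF assms(2)])
  also have "\<dots> = (\<Sum>V\<in>X. (\<Sum>W\<in>X. K N W * M W V) * R V N')"
    by (subst sum.swap) (simp add: sum_distrib_right)
  also have "\<dots> = (\<Sum>V\<in>X. int s * (K N V * R V N') + int s * int t * R V N')"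
    by (intro sum.cong refl) (simp only: KM[OF assms(1)], simp add: algebra_simps)
  also have "\<dots> = int s * (int t * K N N') + int s * int t * int t"
    unfolding sum.distrib
    by (simp add: R_row[OF assms(2)] KR[OF assms(2)] flip: sum_distrib_left)
  finally show ?thesis by (simp add: algebra_simps)
qed

text \<open>This is M (t - R). On vectors whose sum over the lines with any given foot vanishes,
  \<open>R\<close>, \<open>K\<close> and J act as 0, so there M^2 = (s + t) M. \<open>Y\<close> is t
  times \<open>M\<close> on that space and 0 on its orthogonal complement, hence t (s + t) times a
  projection.\<close>

definition "Y N N' = int t * M N N' - K N N'"

lemma Y_square:
  assumes "N \<in> X" "N' \<in> X"
  shows "(\<Sum>W\<in>X. Y N W * Y W N') = int (t * (s + t)) * Y N N'"
proof -
  have "(\<Sum>W\<in>X. Y N W * Y W N') = int t * int t * (\<Sum>W\<in>X. M N W * M W N')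
     - int t * (\<Sum>W\<in>X. M N W * K W N') - int t * (\<Sum>W\<in>X. K N W * M W N') + (\<Sum>W\<in>X. K N W * K W N')"
    unfolding Y_def sum_distrib_left sum_subtractf[symmetric] sum.distrib[symmetric]
    by (intro sum.cong) (auto simp: algebra_simps)
  also have "\<dots> = int (t * (s + t)) * Y N N'"
    unfolding MM[OF assms] MK[OF assms] KM[OF assms] KK[OF assms] K_sym[OF assms(2,1)] Y_def
    by (simp add: algebra_simps)
  finally show ?thesis .
qed

end


section \<open>Skew translation generalized quadrangles\<close>

locale stgq = gq P Ls I s t x
  for P :: "'p set" and Ls :: "'l set" and I :: "'p \<Rightarrow> 'l \<Rightarrow> bool" and s t :: nat and x :: 'p +
  fixes H S :: "(('p \<Rightarrow> 'p) \<times> ('l \<Rightarrow> 'l)) set"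
  assumes autH: "aut_group P Ls I H"
    and fix_x: "\<And>h l. h \<in> H \<Longrightarrow> l \<in> Ls \<Longrightarrow> I x l \<Longrightarrow> snd h l = l"
    and sharp: "\<And>p q. p \<in> far_points P Ls I x \<Longrightarrow> q \<in> far_points P Ls I x \<Longrightarrow> \<exists>!h. h \<in> H \<and> fst h p = q"
    and SH: "S \<subseteq> H" and grpS: "is_group S" and cardS: "card S = t"
    and symS: "\<And>h. h \<in> S \<Longrightarrow> symmetry_about P Ls I x h"
    and star: "property_star P Ls I x H"
begin

section \<open>The action of H: fixed points, symmetries, line stabilizers and the bound t \<le>
  s\<close>

lemma perm:
  assumes "h \<in> H"
  shows "bij (fst h)" "bij (snd h)" "fst h p \<in> P \<longleftrightarrow> p \<in> P" "snd h l \<in> Ls \<longleftrightarrow> l \<in> Ls"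
    "p \<in> P \<Longrightarrow> l \<in> Ls \<Longrightarrow> I (fst h p) (snd h l) \<longleftrightarrow> I p l"
proof -
  have "automorphism P Ls I h" using assms autH unfolding aut_group_def by blast
  then have p: "fst h permutes P" "snd h permutes Ls" "\<And>p l. p \<in> P \<Longrightarrow> l \<in> Ls \<Longrightarrow> I (fst h p) (snd h l) \<longleftrightarrow> I p l"
    unfolding automorphism_def by auto
  show "bij (fst h)" "bij (snd h)" using p permutes_bij by auto
  show "fst h p \<in> P \<longleftrightarrow> p \<in> P" "snd h l \<in> Ls \<longleftrightarrow> l \<in> Ls" using p permutes_in_image by metis+
  show "p \<in> P \<Longrightarrow> l \<in> Ls \<Longrightarrow> I (fst h p) (snd h l) \<longleftrightarrow> I p l" by (rule p(3))
qed

lemma perm_inj: "h \<in> H \<Longrightarrow> fst h p = fst h q \<longleftrightarrow> p = q" "h \<in> H \<Longrightarrow> snd h l = snd h m \<longleftrightarrow> l = m"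
  using perm(1,2) by (meson bij_def inj_eq)+

lemma col_fst: "h \<in> H \<Longrightarrow> p \<in> P \<Longrightarrow> q \<in> P \<Longrightarrow> col p q \<Longrightarrow> col (fst h p) (fst h q)"
  unfolding collinear_def using perm(4,5) by metis

text \<open>All lines through x are fixed, and there are more than one of them; they have only x in
  common.\<close>

lemma fst_x: "h \<in> H \<Longrightarrow> fst h x = x"
proof (rule ccontr)
  assume h: "h \<in> H" and ne: "fst h x \<noteq> x"
  have "card {l \<in> Ls. I x l} \<le> 1"
  proof (subst card_le_Suc0_iff_eq[unfolded One_nat_def[symmetric]])
    show "\<forall>l\<in>{l \<in> Ls. I x l}. \<forall>m\<in>{l \<in> Ls. I x l}. l = m"
    proof (intro ballI)
      fix l m assume lm: "l \<in> {l \<in> Ls. I x l}" "m \<in> {l \<in> Ls. I x l}"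
      have "I (fst h x) l" "I (fst h x) m" using perm(5)[OF h xP] fix_x[OF h] lm by (metis mem_Collect_eq)+
      then show "l = m" using line_unique[of "fst h x" x l m] lm ne xP perm(3)[OF h] by blast
    qed
  qed (use finL in auto)
  then show False using card_lines[OF xP] t1 by simp
qed

lemma col_fst_iff: "h \<in> H \<Longrightarrow> p \<in> P \<Longrightarrow> q \<in> P \<Longrightarrow> col (fst h p) (fst h q) \<longleftrightarrow> col p q"
proof
  assume h: "h \<in> H" and pq: "p \<in> P" "q \<in> P" and c: "col (fst h p) (fst h q)"
  then obtain l where l: "l \<in> Ls" "I (fst h p) l" "I (fst h q) l" unfolding collinear_def by blast
  obtain m where m: "l = snd h m" using perm(2)[OF h] by (meson bij_pointE)
  then show "col p q" using l perm(4,5)[OF h] pq unfolding collinear_def by blast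
qed (rule col_fst)

lemma fst_near: "h \<in> H \<Longrightarrow> near u \<Longrightarrow> near (fst h u)"
  using col_fst[of h x u] fst_x[of h] perm_inj(1)[of h u x] perm(3)[of h u] xP unfolding near_def by auto

lemma fst_far: "h \<in> H \<Longrightarrow> fst h z \<in> far \<longleftrightarrow> z \<in> far"
  using col_fst_iff[of h x z] fst_x[of h] perm(3)[of h z] xP unfolding far_iff by auto

lemma snd_X: "h \<in> H \<Longrightarrow> snd h l \<in> X \<longleftrightarrow> l \<in> X"
  using perm(4)[of h l] perm(5)[of h x l] fst_x[of h] xP unfolding X_def by auto

lemma foot_snd: "h \<in> H \<Longrightarrow> l \<in> X \<Longrightarrow> foot (snd h l) = fst h (foot l)"
  using foot[of l] fst_near[of h "foot l"] perm(5)[of h "foot l" l] snd_X[of h l] XL nearP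
  by (intro foot_eq) auto

lemma sharp_eq: "h \<in> H \<Longrightarrow> g \<in> H \<Longrightarrow> z \<in> far \<Longrightarrow> fst h z = fst g z \<Longrightarrow> h = g"
  using sharp[of z "fst g z"] fst_far[of g z] unfolding far_def by blast

lemma sharp_ex: "z \<in> far \<Longrightarrow> w \<in> far \<Longrightarrow> \<exists>h\<in>H. fst h z = w"
  using sharp[of z w] unfolding far_def by blast

lemma col_image: "h \<in> H \<Longrightarrow> near u \<Longrightarrow> col u (fst h u)"
proof -
  assume h: "h \<in> H" and u: "near u"
  obtain m where m: "m \<in> Ls" "I x m" "I u m" using axis[OF u] by metis
  then have "I (fst h u) m" using perm(5)[OF h nearP[OF u] m(1)] fix_x[OF h m(1,2)] by simp
  then show ?thesis using m colI by blast
qed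

text \<open>The image of w lies on the line joining x and w, and the image of y is collinear with
  both w and the image of w; there are no triangles.\<close>

lemma fix_near:
  assumes "h \<in> H" "near w" "y \<in> far" "col y w" "col (fst h y) w"
  shows "fst h w = w"
  using triangle[OF assms(2) fst_near[OF assms(1,2)] col_image[OF assms(1,2)], of "fst h y"]
    fst_far[OF assms(1)] col_fst[OF assms(1) farP nearP] assms by metis

lemma star_col: "h \<in> H \<Longrightarrow> near u \<Longrightarrow> fst h u = u \<Longrightarrow> near v \<Longrightarrow> col u v \<Longrightarrow> fst h v = v"
proof -
  assume h: "h \<in> H" and u: "near u" "fst h u = u" and v: "near v" "col u v"
  obtain m where "m \<in> Ls" "I x m" "I u m" "I v m" using near_colE[OF u(1) v] .
  then show ?thesis using star h u v unfolding property_star_def near_def by blast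
qed

lemma S_near: "h \<in> S \<Longrightarrow> near u \<Longrightarrow> fst h u = u"
  using symS unfolding symmetry_about_def near_def by blast

lemma ex_near_not_col:
  assumes "near u"
  obtains v where "near v" "\<not> col u v"
proof -
  obtain m where m: "m \<in> Ls" "I x m" "I u m" using axis[OF assms] by metis
  have "\<not> {l \<in> Ls. I x l} \<subseteq> {m}"
    using card_lines[OF xP] t1 card_mono[of "{m}" "{l \<in> Ls. I x l}"] by auto
  then obtain l where l: "l \<in> Ls" "I x l" "l \<noteq> m" by blast
  have "\<not> {p \<in> P. I p l} \<subseteq> {x}"
    using card_points[OF l(1)] s1 card_mono[of "{x}" "{p \<in> P. I p l}"] by auto
  then obtain v where v: "v \<in> P" "I v l" "v \<noteq> x" by blast
  have nv: "near v" using v l colI unfolding near_def by blast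
  have "\<not> col u v"
  proof
    assume "col u v"
    then obtain k where k: "k \<in> Ls" "I x k" "I u k" "I v k" using near_colE[OF assms nv] by metis
    then have "k = m" using line_unique[of x u k m] m assms xP unfolding near_def by blast
    moreover have "k = l" using line_unique[of x v k l] k l v xP by blast
    ultimately show False using l(3) by simp
  qed
  then show thesis using that nv by blast
qed

lemma id_H: "aut_id \<in> H" and id_S: "aut_id \<in> S"
  using autH grpS unfolding aut_group_def is_group_def by auto

text \<open>Symmetries fix a near point v not collinear with the foot of \<open>l\<close>, so they
  send the far point of \<open>l\<close> collinear with v to the projection of v onto the image
  line. The image of one far point determines an element of \<open>H\<close>.\<close>

lemma S_semireg:
  assumes h: "h \<in> S" "g \<in> S" and l: "l \<in> X" "snd h l = snd g l"
  shows "h = g"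
proof -
  note hH = subsetD[OF SH h(1)] and gH = subsetD[OF SH h(2)]
  obtain v where v: "near v" "\<not> col (foot l) v" using ex_near_not_col[OF foot(1)[OF l(1)]] .
  then obtain z where z: "z \<in> far" "I z l" "col z v" using far_proj[OF l(1) v(1)] col_sym by blast
  have hl: "snd h l \<in> X" using snd_X[OF hH] l(1) by blast
  have "I (fst h z) (snd h l)" "I (fst g z) (snd h l)"
    using perm(5)[OF hH farP[OF z(1)] XL[OF l(1)]] perm(5)[OF gH farP[OF z(1)] XL[OF l(1)]] z(2) l(2) by auto
  moreover have "col v (fst h z)" "col v (fst g z)"
    using col_fst[OF hH farP[OF z(1)] nearP[OF v(1)] z(3)] col_fst[OF gH farP[OF z(1)] nearP[OF v(1)] z(3)]
      S_near[OF h(1) v(1)] S_near[OF h(2) v(1)] col_sym by auto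
  moreover have "\<not> I v (snd h l)"
    using foot_eq[OF hl v(1)] foot_snd[OF hH l(1)] S_near[OF h(1) foot(1)[OF l(1)]] v(2) col_refl[OF nearP[OF v(1)]] by metis
  ultimately have "fst h z = fst g z"
    using proj_unique[OF nearP[OF v(1)] XL[OF hl]] fst_far[OF hH] fst_far[OF gH] z(1) farP by blast
  then show ?thesis using sharp_eq[OF hH gH z(1)] by simp
qed

text \<open>By semiregularity the t symmetries produce t distinct images of \<open>l\<close>, and
  exactly t lines of \<open>X\<close> share its foot.\<close>

lemma S_trans:
  assumes "l \<in> X" "l' \<in> X" "foot l = foot l'"
  obtains h where "h \<in> S" "snd h l = l'"
proof -
  have "inj_on (\<lambda>h. snd h l) S" using S_semireg assms(1) unfolding inj_on_def by blast
  then have c: "card ((\<lambda>h. snd h l) ` S) = t" using card_image cardS by metis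
  have sub: "(\<lambda>h. snd h l) ` S \<subseteq> {k \<in> X. foot k = foot l}"
    using snd_X foot_snd S_near foot(1) assms(1) SH by auto
  have "(\<lambda>h. snd h l) ` S = {k \<in> X. foot k = foot l}"
    using card_subset_eq[OF _ sub] c card_foot_eq[OF foot(1)[OF assms(1)]] fin_X by simp
  then have "l' \<in> (\<lambda>h. snd h l) ` S" using assms by simp
  then show thesis using that by blast
qed

lemma ex_foot: "near u \<Longrightarrow> \<exists>l\<in>X. foot l = u"
  using card_foot_eq[of u] t1 by (metis (mono_tags, lifting) Collect_empty_eq card.empty not_less_zero)

text \<open>Some symmetry g agrees with h on a line l with foot u. Both send the far point of l
  collinear with v to the projection of v onto the common image of l, so h = g. This is the
  membership test for \<open>S\<close> used from here on.\<close>

lemma two_fixed_near: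
  assumes h: "h \<in> H" and uv: "near u" "near v" "\<not> col u v" and fixed: "fst h u = u" "fst h v = v"
  shows "h \<in> S"
proof -
  obtain l where l: "l \<in> X" "foot l = u" using ex_foot[OF uv(1)] by blast
  obtain z where z: "z \<in> far" "I z l" "col z v" using far_proj[OF l(1) uv(2)] uv(3) col_sym l(2) by blast
  have hl: "snd h l \<in> X" using snd_X[OF h] l(1) by blast
  have fl: "foot (snd h l) = u" using foot_snd[OF h l(1)] l(2) fixed by simp
  then obtain g where g: "g \<in> S" "snd g l = snd h l" using S_trans[OF l(1) hl] l(2) by metis
  note gH = subsetD[OF SH g(1)]
  have "I (fst h z) (snd h l)" "I (fst g z) (snd h l)"
    using perm(5)[OF h farP[OF z(1)] XL[OF l(1)]] perm(5)[OF gH farP[OF z(1)] XL[OF l(1)]] z(2) g(2) by auto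
  moreover have "col v (fst h z)" "col v (fst g z)"
    using col_fst[OF h farP[OF z(1)] nearP[OF uv(2)] z(3)] col_fst[OF gH farP[OF z(1)] nearP[OF uv(2)] z(3)]
      fixed S_near[OF g(1) uv(2)] col_sym by auto
  moreover have "\<not> I v (snd h l)"
    using foot_eq[OF hl uv(2)] fl uv(3) col_refl[OF nearP[OF uv(2)]] by metis
  ultimately have "fst h z = fst g z"
    using proj_unique[OF nearP[OF uv(2)] XL[OF hl]] fst_far[OF h] fst_far[OF gH] z(1) farP by blast
  then show ?thesis using sharp_eq[OF h gH z(1)] g(1) by simp
qed

text \<open>Both z and its image are collinear with the foot of \<open>l\<close>, which is therefore
  fixed. The line \<open>l\<close> and its image then share the foot and the image of z.\<close>

lemma stab_eqI:
  assumes "h \<in> H" "l \<in> X" "z \<in> far" "I z l" "I (fst h z) l"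
  shows "snd h l = l"
proof -
  have z': "fst h z \<in> far" using fst_far assms by blast
  have "fst h (foot l) = foot l"
    using fix_near[OF assms(1) foot(1)[OF assms(2)] assms(3)] far_foot assms z' by blast
  moreover have "I (fst h z) (snd h l)" using perm(5)[OF assms(1) farP[OF assms(3)] XL[OF assms(2)]] assms(4) by simp
  ultimately show ?thesis
    using X_eqI[OF _ assms(2) z' _ assms(5)] snd_X[OF assms(1)] foot_snd[OF assms(1,2)] assms(2) by metis
qed

lemma stab_bij:
  assumes l: "l \<in> X" and z: "z \<in> far" "I z l"
  shows "bij_betw (\<lambda>h. fst h z) (line_stabilizer H l) {w \<in> far. I w l}"
proof (rule bij_betw_imageI)
  show "inj_on (\<lambda>h. fst h z) (line_stabilizer H l)"
    using sharp_eq[OF _ _ z(1)] unfolding inj_on_def line_stabilizer_def by blast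
  show "(\<lambda>h. fst h z) ` line_stabilizer H l = {w \<in> far. I w l}"
  proof (intro equalityI subsetI)
    fix w assume "w \<in> (\<lambda>h. fst h z) ` line_stabilizer H l"
    then obtain h where h: "h \<in> H" "snd h l = l" "w = fst h z" unfolding line_stabilizer_def by blast
    then show "w \<in> {w \<in> far. I w l}" using perm(5)[OF h(1) farP[OF z(1)] XL[OF l]] fst_far[OF h(1)] z by simp
  next
    fix w assume w: "w \<in> {w \<in> far. I w l}"
    then obtain h where h: "h \<in> H" "fst h z = w" using sharp_ex[OF z(1)] by blast
    then have "snd h l = l" using stab_eqI[OF h(1) l z] w by simp
    then show "w \<in> (\<lambda>h. fst h z) ` line_stabilizer H l" using h unfolding line_stabilizer_def by blast
  qed
qed

lemma ex_far_on: "l \<in> X \<Longrightarrow> \<exists>z\<in>far. I z l"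
  using card_far_on[of l] s1 by (metis (mono_tags, lifting) Collect_empty_eq card.empty not_less_zero)

lemma card_stab: "l \<in> X \<Longrightarrow> card (line_stabilizer H l) = s"
proof -
  assume l: "l \<in> X"
  obtain z where z: "z \<in> far" "I z l" using ex_far_on[OF l] by blast
  show ?thesis using bij_betw_same_card[OF stab_bij[OF l z]] card_far_on[OF l] by simp
qed

lemma card_H: "card H = s * s * t"
proof -
  have "far \<noteq> {}" using card_far s1 t1 by auto
  then obtain z where z: "z \<in> far" by blast
  have "bij_betw (\<lambda>h. fst h z) H far"
  proof (rule bij_betw_imageI)
    show "inj_on (\<lambda>h. fst h z) H" using sharp_eq[OF _ _ z] unfolding inj_on_def by blast
    show "(\<lambda>h. fst h z) ` H = far" using sharp_ex[OF z] fst_far z by (auto simp: image_iff)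
  qed
  then show ?thesis using bij_betw_same_card[of "\<lambda>h. fst h z" H far] card_far by simp
qed

text \<open>Take y far on L0, and a line L whose foot is different from that of L0 but on the same
  line through x. The feet of the t other lines through y project to far points of L. If two of
  these projections agreed, the element of \<open>H\<close> moving y there would fix both feet,
  hence be a symmetry and fix the foot of L0; that foot, the foot of L and the projection would then
  form a triangle. So L has at least t far points.\<close>

lemma t_le_s: "t \<le> s"
proof -
  have "far \<noteq> {}" using card_far s1 t1 by auto
  then obtain y where y: "y \<in> far" by blast
  have "{l \<in> X. I y l} \<noteq> {}" using card_X_through_far[OF y] by force
  then obtain L0 where L0: "L0 \<in> X" "I y L0" by blast
  note n0 = foot(1)[OF L0(1)]
  have "\<not> {v. near v \<and> col v (foot L0)} \<subseteq> {foot L0}"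
    using card_near_col[OF n0] s1 card_mono[of "{foot L0}" "{v. near v \<and> col v (foot L0)}"] by auto
  then obtain u where u: "near u" "col u (foot L0)" "u \<noteq> foot L0" by blast
  obtain L where L: "L \<in> X" "foot L = u" using ex_foot[OF u(1)] by blast
  define Ny where "Ny = {l \<in> X. I y l} - {L0}"
  have cN: "card Ny = t" unfolding Ny_def using card_X_through_far[OF y] L0 fin_X by (subst card_Diff_singleton) auto
  have nc: "\<not> col (foot N) u" if N: "N \<in> Ny" for N
  proof
    assume "col (foot N) u"
    then have "col (foot N) (foot L0)" using near_col_trans[OF foot(1) u(1) n0] N u(2) unfolding Ny_def by blast
    then show False using feet_not_col[of N L0 y] N L0 y unfolding Ny_def by blast
  qed
  have "\<exists>z. z \<in> far \<and> I z L \<and> col z (foot N)" if N: "N \<in> Ny" for N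
    using far_proj[OF L(1), of "foot N"] nc[OF N] foot(1) N L(2) unfolding Ny_def by blast
  then obtain f where f: "\<And>N. N \<in> Ny \<Longrightarrow> f N \<in> far \<and> I (f N) L \<and> col (f N) (foot N)" by metis
  have "inj_on f Ny"
  proof (rule inj_onI, rule ccontr)
    fix N N' assume N: "N \<in> Ny" "N' \<in> Ny" "f N = f N'" "N \<noteq> N'"
    obtain h where h: "h \<in> H" "fst h y = f N" using sharp_ex[OF y] f[OF N(1)] by blast
    have X: "N \<in> X" "N' \<in> X" "I y N" "I y N'" using N unfolding Ny_def by auto
    have "fst h (foot N) = foot N" "fst h (foot N') = foot N'"
      using fix_near[OF h(1) foot(1)[OF X(1)] y far_foot[OF y X(1,3)]]
        fix_near[OF h(1) foot(1)[OF X(2)] y far_foot[OF y X(2,4)]] f[OF N(1)] f[OF N(2)] h(2) N(3) by auto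
    then have "h \<in> S"
      using two_fixed_near[OF h(1) foot(1)[OF X(1)] foot(1)[OF X(2)] feet_not_col[OF X(1,2) N(4) y X(3,4)]] by blast
    then have "fst h (foot L0) = foot L0" using S_near n0 by blast
    then have "col (f N) (foot L0)"
      using col_fst[OF h(1) farP[OF y] nearP[OF n0] far_foot[OF y L0]] h(2) by simp
    moreover have "col (f N) u" using far_foot[of "f N" L] f[OF N(1)] L by simp
    ultimately show False using triangle[OF u(1) n0 u(2)] f[OF N(1)] u(3) by blast
  qed
  then have "card Ny \<le> card {z \<in> far. I z L}"
    using f fin_far by (intro card_inj_on_le[of f]) auto
  then show ?thesis using cN card_far_on[OF L(1)] by simp
qed

end

section \<open>The group H and the fixed lines of its elements\<close>

context stgq begin

definition "G = \<lparr>carrier = H, mult = aut_comp, one = (aut_id :: ('a \<Rightarrow> 'a) \<times> ('b \<Rightarrow> 'b))\<rparr>"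

lemma G_simps [simp]: "carrier G = H" "mult G = aut_comp" "one G = aut_id"
  by (simp_all add: G_def)

lemma aut_comp_apply: "fst (aut_comp g h) p = fst g (fst h p)" "snd (aut_comp g h) l = snd g (snd h l)"
  by (simp_all add: aut_comp_def)

lemma aut_id_apply: "fst aut_id p = p" "snd aut_id l = l"
  by (simp_all add: aut_id_def)

lemma group_G: "group G"
proof (rule groupI)
  show "x \<otimes>\<^bsub>G\<^esub> y \<in> carrier G" if "x \<in> carrier G" "y \<in> carrier G" for x y
    using that autH unfolding aut_group_def is_group_def by simp
  show "\<one>\<^bsub>G\<^esub> \<in> carrier G" using id_H by simp
  show "x \<otimes>\<^bsub>G\<^esub> y \<otimes>\<^bsub>G\<^esub> z = x \<otimes>\<^bsub>G\<^esub> (y \<otimes>\<^bsub>G\<^esub> z)" for x y z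
    by (simp add: aut_comp_def comp_assoc)
  show "\<one>\<^bsub>G\<^esub> \<otimes>\<^bsub>G\<^esub> x = x" for x by (simp add: aut_comp_def aut_id_def)
  fix g assume "g \<in> carrier G"
  then have g: "g \<in> H" by simp
  then have "aut_inv g \<in> H" using autH unfolding aut_group_def is_group_def by blast
  moreover have "aut_comp (aut_inv g) g = aut_id"
    using perm(1,2)[OF g] unfolding aut_comp_def aut_inv_def aut_id_def by (simp add: bij_is_inj)
  ultimately show "\<exists>y\<in>carrier G. y \<otimes>\<^bsub>G\<^esub> g = \<one>\<^bsub>G\<^esub>" by auto
qed

lemma fin_H: "finite H"
  using card_H s1 t1 by (intro card_ge_0_finite) simp

lemma inv_apply:
  assumes "h \<in> H"
  shows "inv\<^bsub>G\<^esub> h \<in> H" "fst (inv\<^bsub>G\<^esub> h) (fst h p) = p" "snd (inv\<^bsub>G\<^esub> h) (snd h l) = l"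
    "fst h (fst (inv\<^bsub>G\<^esub> h) p) = p" "snd h (snd (inv\<^bsub>G\<^esub> h) l) = l"
proof -
  interpret group G by (rule group_G)
  show "inv\<^bsub>G\<^esub> h \<in> H" using inv_closed[of h] assms by simp
  have "aut_comp (inv\<^bsub>G\<^esub> h) h = aut_id" "aut_comp h (inv\<^bsub>G\<^esub> h) = aut_id"
    using l_inv[of h] r_inv[of h] assms by simp_all
  then show "fst (inv\<^bsub>G\<^esub> h) (fst h p) = p" "snd (inv\<^bsub>G\<^esub> h) (snd h l) = l"
    "fst h (fst (inv\<^bsub>G\<^esub> h) p) = p" "snd h (snd (inv\<^bsub>G\<^esub> h) l) = l"
    by (metis aut_comp_apply aut_id_apply)+
qed

lemma subgroupI_aut:
  assumes "T \<subseteq> H" "aut_id \<in> T" "\<And>g h. g \<in> T \<Longrightarrow> h \<in> T \<Longrightarrow> aut_comp g h \<in> T"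
  shows "subgroup T G"
  using group.subgroup_of_finite[OF group_G, of T] fin_H assms by simp

lemma snd_nat_pow: "snd (h [^]\<^bsub>G\<^esub> (k::nat)) = snd h ^^ k" "fst (h [^]\<^bsub>G\<^esub> (k::nat)) = fst h ^^ k"
proof -
  interpret group G by (rule group_G)
  show "snd (h [^]\<^bsub>G\<^esub> k) = snd h ^^ k" "fst (h [^]\<^bsub>G\<^esub> k) = fst h ^^ k"
    by (induction k) (simp_all add: aut_comp_def aut_id_def funpow_swap1 fun_eq_iff)
qed

lemma snd_funpow_order: "h \<in> H \<Longrightarrow> (snd h ^^ card H) l = l"
proof -
  assume h: "h \<in> H"
  interpret group G by (rule group_G)
  have "h [^]\<^bsub>G\<^esub> card H = aut_id" using pow_order_eq_1[of h] h by (simp add: Coset.order_def)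
  then show ?thesis using snd_nat_pow(1)[of h "card H"] by (simp add: aut_id_def)
qed

lemma M_snd:
  assumes h: "h \<in> H" and N: "N \<in> X" "N' \<in> X"
  shows "M (snd h N) (snd h N') = M N N'"
proof -
  have "bij_betw (fst h) {z \<in> far. I z N \<and> I z N'} {z \<in> far. I z (snd h N) \<and> I z (snd h N')}"
  proof (rule bij_betw_imageI)
    show "inj_on (fst h) {z \<in> far. I z N \<and> I z N'}" using perm_inj(1)[OF h] by (simp add: inj_on_def)
    have inc: "I (fst h z) (snd h k) \<longleftrightarrow> I z k" if "z \<in> far" "k \<in> X" for z k
      using perm(5)[OF h farP XL] that by blast
    show "fst h ` {z \<in> far. I z N \<and> I z N'} = {z \<in> far. I z (snd h N) \<and> I z (snd h N')}"
    proof (intro equalityI subsetI)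
      fix w assume w: "w \<in> {z \<in> far. I z (snd h N) \<and> I z (snd h N')}"
      obtain z where z: "w = fst h z" using perm(1)[OF h] by (meson bij_pointE)
      then have "z \<in> far" using w fst_far[OF h] by blast
      then show "w \<in> fst h ` {z \<in> far. I z N \<and> I z N'}" using z w inc N by blast
    qed (use inc N fst_far[OF h] in auto)
  qed
  then show ?thesis unfolding M_def using bij_betw_same_card by fastforce
qed

lemma K_snd:
  assumes h: "h \<in> H" and N: "N \<in> X" "N' \<in> X"
  shows "K (snd h N) (snd h N') = K N N'"
  using N snd_X[OF h] col_fst_iff[OF h nearP[OF foot(1)[OF N(1)]] nearP[OF foot(1)[OF N(2)]]]
  by (simp add: K_val foot_snd[OF h] perm_inj(1)[OF h])

text \<open>A variant of Benson's argument: \<open>Y\<close> divided by \<open>t (s + t)\<close> is a projection commuting with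
  the action on lines, so its twisted trace \<open>- s\<^sup>2 / (s + t)\<close> would have to be an integer.\<close>
lemma fixes_some_line:
  assumes h: "h \<in> H" and u: "near u" "fst h u = u" and nS: "h \<notin> S"
    and p: "prime (p :: nat)" and sp: "s = p ^ e" and ts: "t < s"
  shows "\<exists>N\<in>X. snd h N = N"
proof (rule ccontr)
  assume none: "\<not> (\<exists>N\<in>X. snd h N = N)"
  have bijX: "bij_betw (snd h) X X"
  proof (rule bij_betw_imageI)
    show "inj_on (snd h) X" using perm_inj(2)[OF h] by (simp add: inj_on_def)
    show "snd h ` X = X"
    proof (intro equalityI subsetI)
      fix N assume N: "N \<in> X"
      obtain m where m: "N = snd h m" using perm(2)[OF h] by (meson bij_pointE)
      then show "N \<in> snd h ` X" using N snd_X[OF h] by blast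
    qed (use snd_X[OF h] in auto)
  qed
  \<comment> \<open>A line and its image have collinear feet; being distinct, they share no far
    point, so \<open>M\<close> contributes 0. \<open>K\<close> contributes s when the foot is fixed
    and 0 when it moves along its line through x. By \<open>star\<close> every foot collinear with u
    is fixed; a fixed foot not collinear with u would make h a symmetry.\<close>
  have Yval: "Y N (snd h N) = - int s * of_bool (col (foot N) u)" if N: "N \<in> X" for N
  proof -
    have hN: "snd h N \<in> X" using snd_X[OF h] N by blast
    note nN = foot(1)[OF N]
    have fh: "foot (snd h N) = fst h (foot N)" by (rule foot_snd[OF h N])
    have e: "{z \<in> far. I z N \<and> I z (snd h N)} = {}"
    proof (rule equals0I)
      fix z assume "z \<in> {z \<in> far. I z N \<and> I z (snd h N)}"
      then have z: "z \<in> far" "I z N" "I z (snd h N)" by auto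
      have "N \<noteq> snd h N" using none N by metis
      then have "\<not> col (foot N) (foot (snd h N))" using feet_not_col[OF N hN _ z] by blast
      then show False using col_image[OF h nN] fh by simp
    qed
    have M0: "M N (snd h N) = 0" unfolding M_def e by simp
    show ?thesis
    proof (cases "col (foot N) u")
      case True
      then have "fst h (foot N) = foot N" using star_col[OF h u nN] col_sym by blast
      then show ?thesis using True M0 fh by (simp add: Y_def K_val[OF N hN])
    next
      case False
      have "fst h (foot N) \<noteq> foot N" using two_fixed_near[OF h nN u(1) False] u(2) nS by blast
      then show ?thesis using False M0 fh col_image[OF h nN] by (simp add: Y_def K_val[OF N hN])
    qed
  qed
  have "int (t * (s + t)) dvd (\<Sum>N\<in>X. Y N (snd h N))"
  proof (rule dvd_twisted_trace[OF fin_X bijX])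
    show "int (t * (s + t)) > 0" using s1 t1 by simp
    show "(\<Sum>w\<in>X. Y u w * Y w v) = int (t * (s + t)) * Y u v" if "u \<in> X" "v \<in> X" for u v
      by (rule Y_square[OF that])
    show "Y (snd h u) (snd h v) = Y u v" if "u \<in> X" "v \<in> X" for u v
      unfolding Y_def M_snd[OF h that] K_snd[OF h that] ..
    show "card H > 0" using card_H s1 t1 by simp
    show "(snd h ^^ card H) u = u" for u by (rule snd_funpow_order[OF h])
  qed
  moreover have "(\<Sum>N\<in>X. Y N (snd h N)) = - int s * int (s * t)"
  proof -
    have "(\<Sum>N\<in>X. Y N (snd h N)) = (\<Sum>N\<in>X. - int s * of_bool (col (foot N) u))"
      by (rule sum.cong[OF refl Yval])
    also have "\<dots> = - int s * int (s * t)"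
      unfolding sum_distrib_left[symmetric] sum_of_bool_card[OF fin_X] card_feet_col[OF u(1)] ..
    finally show ?thesis .
  qed
  ultimately have "int (t * (s + t)) dvd int (t * (s * s))" by (simp add: mult_ac)
  then have "t * (s + t) dvd t * (s * s)" by (simp only: int_dvd_int_iff)
  \<comment> \<open>A divisor of a power of p is a power of p; exceeding s = p^e, it is at least p
    s, hence at least 2 s.\<close>
  then have "s + t dvd s * s" using t1 by simp
  then have "s + t dvd p ^ (e + e)" unfolding sp by (simp add: power_add)
  then obtain k where k: "s + t = p ^ k" using divides_primepow_nat[OF p] by blast
  have p1: "p > 1" using p prime_gt_1_nat by blast
  have "p ^ e < p ^ k" using k sp t1 by simp
  then have "e < k" using p1 by simp
  then have "p ^ Suc e \<le> p ^ k" using p1 by (intro power_increasing) auto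
  then have "p * s \<le> s + t" using k sp by simp
  moreover have "2 * s \<le> p * s" using p1 by simp
  ultimately show False using ts by simp
qed

lemma stab_subgroup: "subgroup (line_stabilizer H l) G"
  using id_H group.is_monoid[OF group_G] monoid.m_closed[of G]
  by (intro subgroupI_aut) (auto simp: line_stabilizer_def aut_comp_apply aut_id_apply)

lemma S_subgroup: "subgroup S G"
  using SH id_S grpS unfolding is_group_def by (intro subgroupI_aut) auto

text \<open>A conjugate of a symmetry fixes every near point, and two noncollinear ones suffice for
  membership in \<open>S\<close>.\<close>

lemma S_normal: "S \<lhd> G"
proof -
  interpret group G by (rule group_G)
  have "x \<otimes>\<^bsub>G\<^esub> h \<otimes>\<^bsub>G\<^esub> inv\<^bsub>G\<^esub> x \<in> S" if xh: "x \<in> H" "h \<in> S" for x h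
  proof -
    have hH: "h \<in> H" using xh SH by blast
    have fixed: "fst (x \<otimes>\<^bsub>G\<^esub> h \<otimes>\<^bsub>G\<^esub> inv\<^bsub>G\<^esub> x) w = w" if "near w" for w
      using S_near[OF xh(2) fst_near[OF inv_apply(1)[OF xh(1)] that]]
      by (simp add: aut_comp_apply inv_apply[OF xh(1)])
    have mem: "x \<otimes>\<^bsub>G\<^esub> h \<otimes>\<^bsub>G\<^esub> inv\<^bsub>G\<^esub> x \<in> H"
      using m_closed[of "x \<otimes>\<^bsub>G\<^esub> h" "inv\<^bsub>G\<^esub> x"] m_closed[of x h] inv_closed[of x] xh hH by simp
    have "X \<noteq> {}" using card_far card_H s1 t1 ex_line far_line farP
      by (metis card.empty empty_iff equals0I less_numeral_extra(3) mult_eq_0_iff not_less_zero)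
    then obtain N where "N \<in> X" by blast
    then have n: "near (foot N)" by (rule foot(1))
    obtain v where "near v" "\<not> col (foot N) v" using ex_near_not_col[OF n] .
    then show ?thesis using two_fixed_near[OF mem n] fixed n by blast
  qed
  then show ?thesis unfolding normal_inv_iff using S_subgroup by simp
qed

lemma many_root_elations:
  assumes L: "L \<in> X" and st: "s \<noteq> t"
    and ea: "\<And>N. N \<in> X \<Longrightarrow> elementary_abelian (line_stabilizer H N)"
  shows "t < s" "s \<le> t * card {h \<in> line_stabilizer H L. \<forall>M\<in>Ls. I (foot L) M \<longrightarrow> snd h M = M}"
proof -
  interpret group G by (rule group_G)
  show ts: "t < s" using t_le_s st by simp
  obtain y where y: "y \<in> far" "I y L" using ex_far_on[OF L] by blast
  have "\<not> {l \<in> X. I y l} \<subseteq> {L}"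
    using card_X_through_far[OF y(1)] t1 card_mono[of "{L}" "{l \<in> X. I y l}"] by auto
  then obtain L0 where L0: "L0 \<in> X" "I y L0" "L0 \<noteq> L" by blast
  define A where "A = line_stabilizer H L0"
  define B where "B = line_stabilizer H L"
  define u0 where "u0 = foot L0"
  define u1 where "u1 = foot L"
  have n0: "near u0" and n1: "near u1" unfolding u0_def u1_def using foot(1) L L0 by auto
  have nc: "\<not> col u0 u1" unfolding u0_def u1_def by (rule feet_not_col[OF L0(1) L L0(3) y(1) L0(2) y(2)])
  have A: "subgroup A G" "A \<subseteq> H" and B: "subgroup B G" "B \<subseteq> H"
    unfolding A_def B_def by (auto simp: stab_subgroup) (auto simp: line_stabilizer_def)
  have AL: "snd a L0 = L0" if "a \<in> A" for a using that unfolding A_def line_stabilizer_def by simp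
  have BL: "snd b L = L" if "b \<in> B" for b using that unfolding B_def line_stabilizer_def by simp
  have Au: "fst a u0 = u0" if "a \<in> A" for a using foot_snd[of a L0] that A(2) L0(1) AL unfolding u0_def by auto
  have Bu: "fst b u1 = u1" if "b \<in> B" for b using foot_snd[of b L] that B(2) L BL unfolding u1_def by auto
  have HG: "aut_comp g h \<in> H" if "g \<in> H" "h \<in> H" for g h using m_closed[of g h] that by simp
  obtain p where p: "prime (p::nat)" "\<And>g. g \<in> A \<Longrightarrow> aut_pow g p = aut_id"
    using ea[OF L0(1)] unfolding A_def elementary_abelian_def by blast
  have cA: "card A = s" and cB: "card B = s" unfolding A_def B_def using card_stab L L0(1) by auto
  obtain e where e: "s = p ^ e"
  proof -
    interpret A: group "G\<lparr>carrier := A\<rparr>" using A(1) subgroup_imp_group by blast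
    have "g [^]\<^bsub>G\<lparr>carrier := A\<rparr>\<^esub> p = \<one>\<^bsub>G\<lparr>carrier := A\<rparr>\<^esub>" if "g \<in> A" for g
    proof -
      have "g [^]\<^bsub>G\<^esub> p = aut_pow g p" unfolding aut_pow_def using snd_nat_pow[of g p] by (simp add: prod_eq_iff)
      then show ?thesis using p(2)[OF that] by (simp flip: nat_pow_consistent)
    qed
    then obtain e where "order (G\<lparr>carrier := A\<rparr>) = p ^ e"
      using A.order_prime_power_of_exponent[OF _ p(1)] finite_subset[OF A(2) fin_H] by auto
    then show thesis using that cA by (simp add: Coset.order_def)
  qed
  have Acom: "a \<otimes>\<^bsub>G\<^esub> a' = a' \<otimes>\<^bsub>G\<^esub> a" if "a \<in> A" "a' \<in> A" for a a'
    using ea[OF L0(1)] that unfolding A_def elementary_abelian_def by simp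
  have Bcom: "b \<otimes>\<^bsub>G\<^esub> b' = b' \<otimes>\<^bsub>G\<^esub> b" if "b \<in> B" "b' \<in> B" for b b'
    using ea[OF L] that unfolding B_def elementary_abelian_def by simp
  \<comment> \<open>The element a fixes the line joining x and u0 pointwise, and b^-1 moves u0 along
    that line, so the commutator fixes u0. With the roles of a and b exchanged it fixes u1 as
    well.\<close>
  have comm: "b \<otimes>\<^bsub>G\<^esub> a \<otimes>\<^bsub>G\<^esub> inv\<^bsub>G\<^esub> b \<otimes>\<^bsub>G\<^esub> inv\<^bsub>G\<^esub> a \<in> S" if ab: "a \<in> A" "b \<in> B" for a b
  proof -
    have aH: "a \<in> H" and bH: "b \<in> H" using ab A(2) B(2) by auto
    note aH = aH inv_apply(1)[OF aH] and bH = bH inv_apply(1)[OF bH]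
    have ai: "fst (inv\<^bsub>G\<^esub> a) u0 = u0" using inv_apply(2)[OF aH(1), of u0] Au[OF ab(1)] by simp
    have bi: "fst (inv\<^bsub>G\<^esub> b) u1 = u1" using inv_apply(2)[OF bH(1), of u1] Bu[OF ab(2)] by simp
    have "fst a (fst (inv\<^bsub>G\<^esub> b) u0) = fst (inv\<^bsub>G\<^esub> b) u0"
      by (rule star_col[OF aH(1) n0 Au[OF ab(1)] fst_near[OF bH(2) n0] col_image[OF bH(2) n0]])
    then have f0: "fst (b \<otimes>\<^bsub>G\<^esub> a \<otimes>\<^bsub>G\<^esub> inv\<^bsub>G\<^esub> b \<otimes>\<^bsub>G\<^esub> inv\<^bsub>G\<^esub> a) u0 = u0"
      by (simp add: aut_comp_apply ai inv_apply(4)[OF bH(1)])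
    have "fst (inv\<^bsub>G\<^esub> b) (fst (inv\<^bsub>G\<^esub> a) u1) = fst (inv\<^bsub>G\<^esub> a) u1"
      by (rule star_col[OF bH(2) n1 bi fst_near[OF aH(2) n1] col_image[OF aH(2) n1]])
    then have f1: "fst (b \<otimes>\<^bsub>G\<^esub> a \<otimes>\<^bsub>G\<^esub> inv\<^bsub>G\<^esub> b \<otimes>\<^bsub>G\<^esub> inv\<^bsub>G\<^esub> a) u1 = u1"
      by (simp add: aut_comp_apply inv_apply(4)[OF aH(1)] Bu[OF ab(2)])
    show ?thesis by (rule two_fixed_near[OF _ n0 n1 nc f0 f1]) (simp add: HG aH bH)
  qed
  \<comment> \<open>The factor b is chosen to agree with g at u0: it moves y to the far point of L
    collinear with g u0. Then b^-1 g fixes u0, so it moves L0 to a line with the same foot; a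
    symmetry u does the same, and what is left stabilizes L0.\<close>
  have fact: "\<exists>b\<in>B. \<exists>u\<in>S. \<exists>a\<in>A. g = b \<otimes>\<^bsub>G\<^esub> u \<otimes>\<^bsub>G\<^esub> a" if "g \<in> carrier G" for g
  proof -
    have g: "g \<in> H" using that by simp
    have nv: "near (fst g u0)" and cv: "col u0 (fst g u0)" using fst_near[OF g n0] col_image[OF g n0] by auto
    have "\<not> col (fst g u0) (foot L)" using near_col_trans[OF n0 nv n1 cv] nc unfolding u1_def by blast
    then obtain z where z: "z \<in> far" "I z L" "col z (fst g u0)" using far_proj[OF L nv] by blast
    then obtain b where b: "b \<in> B" "fst b y = z"
      using stab_bij[OF L y] unfolding bij_betw_def B_def by (metis (mono_tags, lifting) imageE mem_Collect_eq)
    have bH: "b \<in> H" using b B(2) by blast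
    have "col z (fst b u0)"
      using col_fst[OF bH farP[OF y(1)] nearP[OF n0]] far_foot[OF y(1) L0(1,2)] b(2) unfolding u0_def by simp
    moreover have "col (fst b u0) (fst g u0)"
      using near_col_trans[OF fst_near[OF bH n0] n0 nv _ cv] col_image[OF bH n0] col_sym by blast
    ultimately have bu: "fst b u0 = fst g u0" using triangle[OF fst_near[OF bH n0] nv _ z(1)] z(3) by blast
    define k where "k = inv\<^bsub>G\<^esub> b \<otimes>\<^bsub>G\<^esub> g"
    have kH: "k \<in> H" unfolding k_def using HG inv_apply(1)[OF bH] g by simp
    have "fst k u0 = u0" unfolding k_def using inv_apply(2)[OF bH, of u0] bu by (simp add: aut_comp_apply)
    then have "foot L0 = foot (snd k L0)" using foot_snd[OF kH L0(1)] unfolding u0_def by simp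
    moreover have "snd k L0 \<in> X" using snd_X[OF kH] L0(1) by blast
    ultimately obtain u where u: "u \<in> S" "snd u L0 = snd k L0" using S_trans[OF L0(1)] by metis
    have uH: "u \<in> H" using u SH by blast
    define a where "a = inv\<^bsub>G\<^esub> u \<otimes>\<^bsub>G\<^esub> k"
    have aH: "a \<in> H" unfolding a_def using HG inv_apply(1)[OF uH] kH by simp
    have "snd a L0 = L0" unfolding a_def using inv_apply(3)[OF uH, of L0] u(2) by (simp add: aut_comp_apply)
    then have "a \<in> A" unfolding A_def line_stabilizer_def using aH by simp
    moreover have "g = b \<otimes>\<^bsub>G\<^esub> u \<otimes>\<^bsub>G\<^esub> a"
      unfolding a_def k_def using g bH uH m_assoc[of b u] inv_mult_cancel_left(2) inv_closed m_closed
      by (metis G_simps(1))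
    ultimately show ?thesis using b u by blast
  qed
  \<comment> \<open>The element u a fixes a line N = g L0, so conjugation by g^-1 brings it to some
    a' in \<open>A\<close>. Since g a' g^-1 lies in S a', comparison of the factorizations in S A
    gives a' = a.\<close>
  have fuse: "\<exists>g\<in>carrier G. g \<otimes>\<^bsub>G\<^esub> a \<otimes>\<^bsub>G\<^esub> inv\<^bsub>G\<^esub> g = u \<otimes>\<^bsub>G\<^esub> a"
    if a: "a \<in> A" "a \<noteq> \<one>\<^bsub>G\<^esub>" and u: "u \<in> S" for a u
  proof -
    have aH: "a \<in> H" and uH: "u \<in> H" using a u A(2) SH by auto
    \<comment> \<open>Elements of \<open>A\<close> fix L0, so the product sends L0 where its
      symmetry does, and semiregularity recovers the symmetry.\<close>
    have uniq: "v = w" if "v \<in> S" "w \<in> S" "b \<in> A" "c \<in> A" "v \<otimes>\<^bsub>G\<^esub> b = w \<otimes>\<^bsub>G\<^esub> c" for v w b c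
    proof -
      have "snd v (snd b L0) = snd w (snd c L0)" using that(5) aut_comp_apply(2) by (metis G_simps(2))
      then show ?thesis using S_semireg[OF that(1,2) L0(1)] AL that by simp
    qed
    define h where "h = u \<otimes>\<^bsub>G\<^esub> a"
    have hH: "h \<in> H" unfolding h_def using HG uH aH by simp
    have hu: "fst h u0 = u0" unfolding h_def using Au[OF a(1)] S_near[OF u n0] by (simp add: aut_comp_apply)
    have nS: "h \<notin> S"
    proof
      assume "h \<in> S"
      moreover have oA: "\<one>\<^bsub>G\<^esub> \<in> A" using A(1) subgroup.one_closed by blast
      moreover have "h \<otimes>\<^bsub>G\<^esub> \<one>\<^bsub>G\<^esub> = u \<otimes>\<^bsub>G\<^esub> a" unfolding h_def using r_one[of "u \<otimes>\<^bsub>G\<^esub> a"] HG uH aH by simp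
      ultimately have "h = u" using uniq[of h u "\<one>\<^bsub>G\<^esub>" a] u a by blast
      then show False unfolding h_def using a(2) aH uH l_cancel_one[of u a] by simp
    qed
    obtain N where N: "N \<in> X" "snd h N = N" using fixes_some_line[OF hH n0 hu nS p(1) e ts] by blast
    have nN: "near (foot N)" by (rule foot(1)[OF N(1)])
    have "fst h (foot N) = foot N" using foot_snd[OF hH N(1)] N(2) by simp
    then have cN: "col (foot N) u0" using two_fixed_near[OF hH nN n0] hu nS by blast
    obtain z where z: "z \<in> far" "I z N" using ex_far_on[OF N(1)] by blast
    \<comment> \<open>Moving y to a far point of N already carries L0 to N: the image of L0 passes
      through z with its foot on the line joining x and u0, and only one line does so.\<close>
    obtain g where g: "g \<in> H" "fst g y = z" using sharp_ex[OF y(1) z(1)] by blast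
    have "col z (fst g u0)"
      using col_fst[OF g(1) farP[OF y(1)] nearP[OF n0]] far_foot[OF y(1) L0(1,2)] g(2) unfolding u0_def by simp
    moreover have "col (foot N) (fst g u0)"
      by (rule near_col_trans[OF nN n0 fst_near[OF g(1) n0] cN col_image[OF g(1) n0]])
    ultimately have "foot N = fst g u0"
      using triangle[OF nN fst_near[OF g(1) n0] _ z(1) far_foot[OF z(1) N(1) z(2)]] by blast
    then have "foot (snd g L0) = foot N" using foot_snd[OF g(1) L0(1)] unfolding u0_def by simp
    moreover have "I z (snd g L0)" using perm(5)[OF g(1) farP[OF y(1)] XL[OF L0(1)]] L0(2) g(2) by simp
    moreover have "snd g L0 \<in> X" using snd_X[OF g(1)] L0(1) by blast
    ultimately have gN: "snd g L0 = N" using X_eqI[OF _ N(1) z(1) _ z(2)] by blast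
    define a' where "a' = inv\<^bsub>G\<^esub> g \<otimes>\<^bsub>G\<^esub> h \<otimes>\<^bsub>G\<^esub> g"
    have a'H: "a' \<in> H" unfolding a'_def using HG inv_apply(1)[OF g(1)] g(1) hH by simp
    have "snd a' L0 = L0" unfolding a'_def using inv_apply(3)[OF g(1), of L0] gN N(2) by (simp add: aut_comp_apply)
    then have a'A: "a' \<in> A" unfolding A_def line_stabilizer_def using a'H by simp
    have hg: "g \<otimes>\<^bsub>G\<^esub> a' \<otimes>\<^bsub>G\<^esub> inv\<^bsub>G\<^esub> g = h"
    proof -
      have "g \<otimes>\<^bsub>G\<^esub> a' = h \<otimes>\<^bsub>G\<^esub> g"
        unfolding a'_def using g(1) hH m_assoc[of "inv\<^bsub>G\<^esub> g" h g] inv_mult_cancel_left(2)[of g "h \<otimes>\<^bsub>G\<^esub> g"]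
          inv_apply(1)[OF g(1)] HG by simp
      then show ?thesis using g(1) hH m_assoc[of h g "inv\<^bsub>G\<^esub> g"] r_inv[of g] r_one[of h] inv_apply(1)[OF g(1)] by simp
    qed
    obtain w where w: "w \<in> S" "g \<otimes>\<^bsub>G\<^esub> a' \<otimes>\<^bsub>G\<^esub> inv\<^bsub>G\<^esub> g = w \<otimes>\<^bsub>G\<^esub> a'"
    proof (rule conj_mem_normal_coset[OF S_normal A(1) Acom _ comm fact a'A])
      show "B \<subseteq> carrier G" "g \<in> carrier G" using B(2) g(1) by simp_all
    qed
    then have eq: "w \<otimes>\<^bsub>G\<^esub> a' = u \<otimes>\<^bsub>G\<^esub> a" using hg h_def by simp
    then have "w = u" using uniq[OF w(1) u a'A a(1)] by blast
    then have "a' = a" using eq Units_l_cancel[of u a' a] uH aH a'H by (simp add: Units_eq)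
    then show ?thesis using hg g(1) h_def by auto
  qed
  have "s \<le> t * card {b \<in> B. \<forall>u\<in>S. b \<otimes>\<^bsub>G\<^esub> u = u \<otimes>\<^bsub>G\<^esub> b}"
  proof (rule centralizer_of_normal_factor[OF p(1) e _ _ ts S_normal cardS A(1) cA Acom B(1) cB Bcom comm fact fuse])
    show "order G = s * s * t" using card_H by (simp add: Coset.order_def)
    show "t > 0" using t1 by simp
  qed
  also have "card {b \<in> B. \<forall>u\<in>S. b \<otimes>\<^bsub>G\<^esub> u = u \<otimes>\<^bsub>G\<^esub> b}
    \<le> card {h \<in> line_stabilizer H L. \<forall>M\<in>Ls. I (foot L) M \<longrightarrow> snd h M = M}"
  proof (rule card_mono)
    show "finite {h \<in> line_stabilizer H L. \<forall>M\<in>Ls. I (foot L) M \<longrightarrow> snd h M = M}"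
      using fin_H unfolding line_stabilizer_def by simp
    show "{b \<in> B. \<forall>u\<in>S. b \<otimes>\<^bsub>G\<^esub> u = u \<otimes>\<^bsub>G\<^esub> b}
      \<subseteq> {h \<in> line_stabilizer H L. \<forall>M\<in>Ls. I (foot L) M \<longrightarrow> snd h M = M}"
    proof
      fix b assume "b \<in> {b \<in> B. \<forall>u\<in>S. b \<otimes>\<^bsub>G\<^esub> u = u \<otimes>\<^bsub>G\<^esub> b}"
      then have b: "b \<in> B" "\<And>u. u \<in> S \<Longrightarrow> aut_comp b u = aut_comp u b" by auto
      have bH: "b \<in> H" using b B(2) by blast
      obtain m where m: "m \<in> Ls" "I x m" "I (foot L) m" "\<And>l. l \<in> Ls \<Longrightarrow> I (foot L) l \<Longrightarrow> l = m \<or> l \<in> X"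
        using axis[OF foot(1)[OF L]] by metis
      have "snd b N = N" if N: "N \<in> Ls" "I (foot L) N" for N
      proof (cases "N = m")
        case True
        then show ?thesis using fix_x[OF bH m(1,2)] by simp
      next
        case False
        then have NX: "N \<in> X" using m(4)[OF N] by blast
        have "foot L = foot N" using foot_eq[OF NX foot(1)[OF L] N(2)] by simp
        then obtain u where u: "u \<in> S" "snd u L = N" using S_trans[OF L NX] by blast
        have "snd b (snd u L) = snd u (snd b L)" using b(2)[OF u(1)] by (metis aut_comp_apply(2))
        then show ?thesis using u(2) BL[OF b(1)] by simp
      qed
      then show "b \<in> {h \<in> line_stabilizer H L. \<forall>M\<in>Ls. I (foot L) M \<longrightarrow> snd h M = M}"
        using b(1) unfolding B_def by blast
    qed
  qed
  finally show "s \<le> t * card {h \<in> line_stabilizer H L. \<forall>M\<in>Ls. I (foot L) M \<longrightarrow> snd h M = M}"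
    by (simp add: mult_le_mono2)
qed

end

theorem mainTheorem15:
  fixes P :: "'p set" and Ls :: "'l set" and I :: "'p \<Rightarrow> 'l \<Rightarrow> bool"
    and s t :: nat and x :: 'p and H :: "(('p \<Rightarrow> 'p) \<times> ('l \<Rightarrow> 'l)) set"
  assumes "skew_translation_GQ P Ls I s t x H"
    and "s > 1" and "t > 1" and "s \<noteq> t"
    and "property_star P Ls I x H"
    and "\<forall>L\<in>Ls. \<not> I x L \<longrightarrow> elementary_abelian (line_stabilizer H L)"
  shows "\<forall>L\<in>Ls. \<not> I x L \<longrightarrow>
           1 < real s / real t \<and>
           real s / real t \<le> real (card {h \<in> line_stabilizer H L.
              \<forall>M\<in>Ls. I (proj P Ls I L x) M \<longrightarrow> snd h M = M})"
proof (intro ballI impI)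
  fix L assume L: "L \<in> Ls" "\<not> I x L"
  obtain S where S: "S \<subseteq> H" "is_group S" "card S = t" "\<And>h. h \<in> S \<Longrightarrow> symmetry_about P Ls I x h"
    using assms(1) unfolding skew_translation_GQ_def by blast
  have el: "finite_GQ P Ls I s t" "x \<in> P" "aut_group P Ls I H"
    "\<forall>h\<in>H. \<forall>l\<in>Ls. I x l \<longrightarrow> snd h l = l"
    "\<forall>p\<in>far_points P Ls I x. \<forall>q\<in>far_points P Ls I x. \<exists>!h. h \<in> H \<and> fst h p = q"
    using assms(1) unfolding skew_translation_GQ_def elation_GQ_def by blast+
  interpret stgq P Ls I s t x H S
    by unfold_locales (use assms(2,3,5) S el in blast)+
  have "L \<in> X" using L unfolding X_def by simp
  from many_root_elations[OF this assms(4)] assms(6)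
  have ts: "t < s" and le: "s \<le> t * card {h \<in> line_stabilizer H L. \<forall>M\<in>Ls. I (proj P Ls I L x) M \<longrightarrow> snd h M = M}"
    unfolding foot_def X_def by auto
  have "real s \<le> real t * real (card {h \<in> line_stabilizer H L. \<forall>M\<in>Ls. I (proj P Ls I L x) M \<longrightarrow> snd h M = M})"
    unfolding of_nat_mult[symmetric] of_nat_le_iff by (rule le)
  then show "1 < real s / real t \<and>
      real s / real t \<le> real (card {h \<in> line_stabilizer H L.
        \<forall>M\<in>Ls. I (proj P Ls I L x) M \<longrightarrow> snd h M = M})"
    using ts t1 by (simp add: divide_le_eq mult.commute)
qed

end
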